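(* Let $r>0$, $d\ge 1$, and let $\gamma=(\gamma_j)_{j\in\mathbb Z}$, $\alpha=(\alpha_j)_{j\in\mathbb Z}$, $\omega=(\omega_j)_{j\in\mathbb Z}$ be strictly positive symmetric sequences with $\gamma_0=\omega_0=\alpha_0=1$, $\gamma_j\ge 1$ for all $j\in\mathbb Z$, $(\omega_n/\gamma_n)_{n\in\mathbb N_0}$ and $(\alpha_n)_{n\in\mathbb N_0}$ both non-increasing, and $\sum_{j\in\mathbb Z}\alpha_j<\infty$. In addition assume that there exists a density $f$ in $\mathcal F_\alpha^{\sqrt d}$ with $f\ge 1/2$. For $m\in\mathbb N$ put $$\Phi_m=\max_{k\in\mathbb N}\Big\{\frac{\omega_k}{\gamma_k}\min\Big(1,\frac{1}{m\alpha_k}\Big)\Big\}.$$ Then, for any $m\in\mathbb N$ (and any $n\in\mathbb N$), $$\inf_{\widetilde\lambda}\ \sup_{\lambda\in\Lambda_\gamma^r}\ \sup_{f\in\mathcal F_\alpha^d}\mathbb E\big[\|\widetilde\lambda-\lambda\|_\omega^2\big]\ \ge\ \frac{1-\sqrt3/2}{8}\cdot\zeta^2 r d^{-1/2}\cdot\Phi_m,$$ where $\zeta=\min\{1/(4\sqrt d),\,1-d^{-1/4}\}$ and the infimum is taken over all estimators $\widetilde\lambda$ of $\lambda$ based on the observations $N_1,\dots,N_n$ and $Y_1,\dots,Y_m$ described in the context.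
   Context: Notation. $\mathbb N=\{1,2,\dots\}$; $\mathbb L^2=\mathbb L^2([0,1),dx)$; $\mathbf e_j(t)=\exp(2\pi i j t)$; for $g\in\mathbb L^2$, $[g]_j=\int_0^1 g(t)\mathbf e_j(-t)\,dt$. A sequence $(a_j)_{j\in\mathbb Z}$ is symmetric if $a_{-j}=a_j$. For a strictly positive symmetric sequence $\omega$, $\|g\|_\omega^2=\sum_{j\in\mathbb Z}\omega_j|[g]_j|^2$ (similarly $\|\cdot\|_\gamma$). Observation model. $\lambda\in\mathbb L^2$ is a non-negative intensity function and $f\in\mathbb L^2$ a probability density on $[0,1)$, both unknown. Let $\widetilde N_i=\sum_j\delta_{x_{ij}}$, $i=1,\dots,n$, be independent Poisson point processes on $[0,1)$ with intensity function $\lambda$ (with respect to Lebesgue measure), and let $\epsilon_{ij}$ be i.i.d. with density $f$, independent of the $\widetilde N_i$. One observes $N_i=\sum_j\delta_{y_{ij}}$, $i=1,\dots,n$, where $y_{ij}=x_{ij}+\epsilon_{ij}-\lfloor x_{ij}+\epsilon_{ij}\rfloor$, so that $N_1,\dots,N_n$ are i.i.d. Poisson point processes on $[0,1)$ with intensity function the circular convolution $\ell(t)=(\lambda\star f)(t)=\int_0^1\lambda((t-\epsilon)-\lfloor t-\epsilon\rfloor)f(\epsilon)\,d\epsilon$. In addition, one observes an i.i.d. sample $Y_1,\dots,Y_m$ with density $f$, independent of $N_1,\dots,N_n$. $\mathbb E$ denotes expectation under the law of the observations given by $(\lambda,f)$. Classes. $\Lambda_\gamma^r=\{\lambda\in\mathbb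 L^2:\lambda\ge0,\ \sum_{j\in\mathbb Z}\gamma_j|[\lambda]_j|^2\le r\}$ and, for any $d\ge1$, $\mathcal F_\alpha^d=\{f\in\mathbb L^2: f\ge0,\ [f]_0=1,\ d^{-1}\le|[f]_j|^2/\alpha_j\le d\ \text{for all } j\in\mathbb Z\}$; $\mathcal F_\alpha^{\sqrt d}$ is this class with $d$ replaced by $\sqrt d$. *)

theory Defs
  imports "HOL-Probability.Probability"
begin

section \<open>Square-integrable functions on \<open>[0,1)\<close>\<close>

abbreviation circle :: "real measure" where
  "circle \<equiv> restrict_space lborel {0..<1}"

text \<open>
  Elements of \<open>L\<^sup>2\<close> are represented by functions on \<^typ>\<open>real\<close> of which only the restriction to
  \<open>[0,1)\<close> matters; pointwise conditions on them are imposed almost everywhere.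
\<close>

definition L2 :: "(real \<Rightarrow> 'b::{real_normed_vector,second_countable_topology}) set" where
  "L2 = {g \<in> borel_measurable circle. integrable circle (\<lambda>t. (norm (g t))\<^sup>2)}"

definition trig :: "int \<Rightarrow> real \<Rightarrow> complex" where
  "trig j t = exp (2 * of_real pi * \<i> * of_int j * of_real t)"

definition fourier_coeff :: "(real \<Rightarrow> complex) \<Rightarrow> int \<Rightarrow> complex" where
  "fourier_coeff g j = (LINT t|circle. g t * trig j (- t))"

definition weighted_norm_sq :: "(int \<Rightarrow> real) \<Rightarrow> (real \<Rightarrow> complex) \<Rightarrow> ennreal" where
  "weighted_norm_sq w g =
    (\<Sum>\<^sub>\<infinity>j\<in>UNIV. ennreal (w j * (cmod (fourier_coeff g j))\<^sup>2))"

definition Lambda_class :: "(int \<Rightarrow> real) \<Rightarrow> real \<Rightarrow> (real \<Rightarrow> real) set" where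
  "Lambda_class \<gamma> r = {lam \<in> L2. (AE t in circle. 0 \<le> lam t) \<and>
     weighted_norm_sq \<gamma> (\<lambda>t. of_real (lam t)) \<le> ennreal r}"

definition F_class :: "(int \<Rightarrow> real) \<Rightarrow> real \<Rightarrow> (real \<Rightarrow> real) set" where
  "F_class \<alpha> d = {f \<in> L2. (AE t in circle. 0 \<le> f t) \<and>
     fourier_coeff (\<lambda>t. of_real (f t)) 0 = 1 \<and>
     (\<forall>j. 1 / d \<le> (cmod (fourier_coeff (\<lambda>t. of_real (f t)) j))\<^sup>2 / \<alpha> j \<and>
          (cmod (fourier_coeff (\<lambda>t. of_real (f t)) j))\<^sup>2 / \<alpha> j \<le> d)}"


section \<open>Poisson point processes\<close>

text \<open>
  A finite point measure \<open>\<Sum>\<^sub>j \<delta>\<^bsub>x\<^sub>j\<^esub>\<close> is represented by the finite multiset of its atoms.  Finite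
  configurations suffice because all intensity measures considered are finite.
\<close>

definition points_in :: "'b set \<Rightarrow> 'b multiset \<Rightarrow> nat" where
  "points_in B A = size (filter_mset (\<lambda>x. x \<in> B) A)"

text \<open>The \<open>\<sigma>\<close>-algebra on configurations is the one generated by all counting maps.\<close>

definition configurations :: "'b measure \<Rightarrow> 'b multiset measure" where
  "configurations S = sigma {A. set_mset A \<subseteq> space S}
     {{A. set_mset A \<subseteq> space S \<and> points_in B A = k} | B k. B \<in> sets S}"

text \<open>
  The Poisson weights are written out because \<^const>\<open>poisson_pmf\<close> is specified for positive rates
  only, whereas \<^term>\<open>measure L B = 0\<close> has to be allowed here.
\<close>

definition poisson_point_process :: "'a measure \<Rightarrow> 'b measure \<Rightarrow> ('a \<Rightarrow> 'b multiset) \<Rightarrow> bool" where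
  "poisson_point_process P L N \<longleftrightarrow>
     finite_measure L \<and>
     N \<in> measurable P (configurations L) \<and>
     (\<forall>B\<in>sets L. \<forall>k. measure P {w \<in> space P. points_in B (N w) = k} =
        measure L B ^ k / fact k * exp (- measure L B)) \<and>
     (\<forall>(I :: nat set) B. finite I \<longrightarrow> B ` I \<subseteq> sets L \<longrightarrow> disjoint_family_on B I \<longrightarrow>
        prob_space.indep_vars P (\<lambda>_. count_space UNIV) (\<lambda>i w. points_in (B i) (N w)) I)"


section \<open>The observation model\<close>

text \<open>
  Under \<open>P\<close>, the hidden process number \<open>i\<close> has the points \<open>x\<^sub>i\<^sub>j\<close> for \<open>j < K\<^sub>i\<close> (the values \<open>x\<^sub>i\<^sub>j\<close> for
  \<open>j \<ge> K\<^sub>i\<close> play no role); each of its points is shifted by a noise variable and wrapped around the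
  circle.  The noise is independent of the enumerated points and not just of the point measures:
  otherwise the order of enumeration could depend on the noise, and the shifted process would in
  general no longer be Poisson with intensity the circular convolution of \<open>lam\<close> and \<open>f\<close>.

  Independence of random elements with different codomains is independence of the
  \<open>\<sigma>\<close>-algebras they generate.
\<close>

locale shifted_poisson_model = prob_space P for P :: "'a measure" +
  fixes n m :: nat
    and lam f :: "real \<Rightarrow> real"
    and K :: "nat \<Rightarrow> 'a \<Rightarrow> nat"
    and x \<epsilon> :: "nat \<Rightarrow> nat \<Rightarrow> 'a \<Rightarrow> real"
    and N :: "nat \<Rightarrow> 'a \<Rightarrow> real multiset"
    and Y :: "nat \<Rightarrow> 'a \<Rightarrow> real"
  assumes K_measurable: "i \<in> {1..n} \<Longrightarrow> K i \<in> measurable P (count_space UNIV)"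
    and x_measurable: "i \<in> {1..n} \<Longrightarrow> x i j \<in> measurable P circle"
    and hidden_poisson: "i \<in> {1..n} \<Longrightarrow>
      poisson_point_process P (density circle (\<lambda>t. ennreal (lam t)))
        (\<lambda>w. image_mset (\<lambda>j. x i j w) (mset_set {..<K i w}))"
    and hidden_indep: "indep_vars (\<lambda>_. configurations circle)
        (\<lambda>i w. image_mset (\<lambda>j. x i j w) (mset_set {..<K i w})) {1..n}"
    and noise_density: "i \<in> {1..n} \<Longrightarrow> distributed P circle (\<epsilon> i j) (\<lambda>t. ennreal (f t))"
    and noise_indep: "indep_vars (\<lambda>_. circle) (\<lambda>(i, j). \<epsilon> i j) ({1..n} \<times> UNIV)"
    and noise_indep_hidden: "indep_set
        (sets (vimage_algebra (space P) (\<lambda>w. \<lambda>i\<in>{1..n}. (K i w, \<lambda>j. x i j w))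
           (PiM {1..n} (\<lambda>_. count_space UNIV \<Otimes>\<^sub>M PiM UNIV (\<lambda>_. circle)))))
        (sets (vimage_algebra (space P) (\<lambda>w. \<lambda>(i, j)\<in>{1..n} \<times> UNIV. \<epsilon> i j w)
           (PiM ({1..n} \<times> UNIV) (\<lambda>_. circle))))"
    and observed: "i \<in> {1..n} \<Longrightarrow> w \<in> space P \<Longrightarrow>
      N i w = image_mset (\<lambda>j. frac (x i j w + \<epsilon> i j w)) (mset_set {..<K i w})"
    and sample_density: "k \<in> {1..m} \<Longrightarrow> distributed P circle (Y k) (\<lambda>t. ennreal (f t))"
    and sample_indep: "indep_vars (\<lambda>_. circle) Y {1..m}"
    and sample_indep_observed: "indep_set
        (sets (vimage_algebra (space P) (\<lambda>w. \<lambda>i\<in>{1..n}. N i w)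
           (PiM {1..n} (\<lambda>_. configurations circle))))
        (sets (vimage_algebra (space P) (\<lambda>w. \<lambda>k\<in>{1..m}. Y k w)
           (PiM {1..m} (\<lambda>_. circle))))"


section \<open>Estimators and their risk\<close>

definition observation_space :: "nat \<Rightarrow> nat \<Rightarrow> ((nat \<Rightarrow> real multiset) \<times> (nat \<Rightarrow> real)) measure" where
  "observation_space n m =
     PiM {1..n} (\<lambda>_. configurations circle) \<Otimes>\<^sub>M PiM {1..m} (\<lambda>_. circle)"

text \<open>
  An estimator is a measurable map from the observations into (complex) \<open>L\<^sup>2\<close>.  As \<open>L\<^sup>2\<close> is separable,
  its Borel \<open>\<sigma>\<close>-algebra is generated by the coordinates in the trigonometric basis.
\<close>

definition estimators ::
  "nat \<Rightarrow> nat \<Rightarrow> ((nat \<Rightarrow> real multiset) \<times> (nat \<Rightarrow> real) \<Rightarrow> real \<Rightarrow> complex) set" where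
  "estimators n m = {est. (\<forall>z\<in>space (observation_space n m). est z \<in> L2) \<and>
     (\<forall>j. (\<lambda>z. fourier_coeff (est z) j) \<in> borel_measurable (observation_space n m))}"

definition risk ::
  "(int \<Rightarrow> real) \<Rightarrow> 'a measure \<Rightarrow> nat \<Rightarrow> nat \<Rightarrow> (nat \<Rightarrow> 'a \<Rightarrow> real multiset) \<Rightarrow> (nat \<Rightarrow> 'a \<Rightarrow> real) \<Rightarrow>
   ((nat \<Rightarrow> real multiset) \<times> (nat \<Rightarrow> real) \<Rightarrow> real \<Rightarrow> complex) \<Rightarrow> (real \<Rightarrow> real) \<Rightarrow> ennreal" where
  "risk \<omega> P n m N Y est lam =
     (\<integral>\<^sup>+w. weighted_norm_sq \<omega>
        (\<lambda>t. est (\<lambda>i\<in>{1..n}. N i w, \<lambda>k\<in>{1..m}. Y k w) t - of_real (lam t)) \<partial>P)"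

text \<open>
  The supremum below is a maximum whenever the sequences are positive, \<open>\<omega>/\<gamma>\<close> is non-increasing and
  \<open>\<alpha>\<close> tends to \<open>0\<close>: the second factor is then \<open>1\<close> from some \<open>k\<close> on.
\<close>

definition Phi :: "(int \<Rightarrow> real) \<Rightarrow> (int \<Rightarrow> real) \<Rightarrow> (int \<Rightarrow> real) \<Rightarrow> nat \<Rightarrow> real" where
  "Phi \<omega> \<gamma> \<alpha> m = (SUP k\<in>{1::nat..}.
     \<omega> (int k) / \<gamma> (int k) * min 1 (1 / (real m * \<alpha> (int k))))"

end

theory Submission
  imports Defs
begin

text \<open>
  Two hypotheses are compared. For a frequency \<open>k\<close> and \<open>\<tau> = \<plusminus>a\<close>, the \<open>k\<close>-th Fourier coefficients of a
  fixed density \<open>f \<ge> 1/2\<close> and of an intensity \<open>A + B cos (2\<pi>kt)\<close> are multiplied by \<open>1 + \<tau>\<close> and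
  \<open>1 - \<tau>\<close> respectively. The circular convolution sees only \<open>(1 + \<tau>) (1 - \<tau>) = 1 - a\<^sup>2\<close>, so the point
  processes have the same law under both hypotheses and only the sample from the density separates
  them. For \<open>a\<^sup>2\<close> of order \<open>min 1 (1 / (m \<alpha>\<^sub>k))\<close> the Hellinger affinity of the two \<open>m\<close>-fold products
  stays bounded away from \<open>0\<close>, and Le Cam's two-point argument gives the bound.

  That the law of \<open>N\<^sub>1, \<dots>, N\<^sub>n\<close> depends on the convolution only is read off the generating functional
  \<open>E (\<Prod>\<^sub>i \<Prod>\<^bsub>y \<in> N\<^sub>i\<^esub> u\<^sub>i y)\<close>: integrating out the noise replaces \<open>u\<^sub>i\<close> by a smoothed function \<open>v\<^sub>i\<close>, and
  the Poisson property of the hidden processes gives \<open>\<Prod>\<^sub>i exp (\<integral> (v\<^sub>i - 1) \<lambda>)\<close>. For \<open>u\<^sub>i\<close> a product of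
  factors \<open>s\<close> on sets \<open>B\<close>, the functional is the joint probability generating function of the
  counts, which determines their law.
\<close>

section \<open>Probability generating functions\<close>

text \<open>Origin of the constants. Put D = d^(1/4): the given density lies in the class with
  constant D^2, its perturbations may use D^4. The bound \<zeta> \<le> 1 - 1/D keeps 1 + \<tau> and
  1 - \<tau> between 1/D and D, so squared coefficients change at most by a factor D^2 either way.
  The bound \<zeta> \<le> 1/(4 D^2) keeps the perturbation of the density at most 1/2, hence below
  f, and makes the affinity of one observation at least 1 - 1/(2m); by Bernoulli's inequality the
  m-fold affinity is then at least 1/2. Affinity 1/2 classically gives an overlap of at least 1 -
  sqrt(1 - 1/4) = 1 - sqrt 3 / 2. Here a linear inequality yields 1/8 instead, and counting the loss
  at both k and -k leads to 1/32 for each frequency, which exceeds (1 - sqrt 3 / 2) / 8. Each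
  frequency has its own pair of hypotheses while the estimator is fixed beforehand, so the maximum
  over k is taken after the two-point bound.\<close>

lemma (in prob_space) expectation_weighted_power_sums:
  fixes X :: "'a \<Rightarrow> nat" and g :: "'a \<Rightarrow> real"
  assumes [measurable]: "g \<in> borel_measurable M" "X \<in> measurable M (count_space UNIV)"
    and g: "\<And>w. \<bar>g w\<bar> \<le> 1" and s: "\<bar>s\<bar> \<le> 1"
  shows "(\<lambda>k. expectation (\<lambda>w. g w * of_bool (X w = k)) * s ^ k)
           sums expectation (\<lambda>w. g w * s ^ X w)"
proof -
  have gs: "\<bar>g w * s ^ j\<bar> \<le> 1" for w j
    using g[of w] s by (simp add: abs_mult power_abs mult_le_one power_le_one)
  have int: "integrable M (\<lambda>w. g w * of_bool (X w = k) * s ^ k)" for k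
    using gs by (intro integrable_const_bound[where B = 1]) (auto simp: of_bool_def)
  \<comment> \<open>Only the term \<open>k = X w\<close> survives, so the partial sums are the full
    integrand cut off at \<open>X w < j\<close>, dominated by 1. The weight \<open>g\<close> is
    there to carry the other variables of a joint generating function.\<close>
  have eq: "(\<Sum>k<j. g w * of_bool (X w = k) * s ^ k) = of_bool (X w < j) * (g w * s ^ X w)" for j w
  proof -
    have "(\<Sum>k<j. g w * of_bool (X w = k) * s ^ k) = (\<Sum>k<j. if k = X w then g w * s ^ X w else 0)"
      by (intro sum.cong) auto
    then show ?thesis by (simp add: sum.delta')
  qed
  have "(\<lambda>j. expectation (\<lambda>w. of_bool (X w < j) * (g w * s ^ X w)))
          \<longlonglongrightarrow> expectation (\<lambda>w. g w * s ^ X w)"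
  proof (rule integral_dominated_convergence[where w = "\<lambda>_. 1"])
    show "AE w in M. (\<lambda>j. of_bool (X w < j) * (g w * s ^ X w)) \<longlonglongrightarrow> g w * s ^ X w"
    proof (intro AE_I2 tendsto_eventually)
      fix w
      show "\<forall>\<^sub>F j in sequentially. of_bool (X w < j) * (g w * s ^ X w) = g w * s ^ X w"
        using eventually_gt_at_top[of "X w"] by eventually_elim simp
    qed
  qed (use gs in \<open>auto simp: of_bool_def\<close>)
  moreover have "(\<Sum>k<j. expectation (\<lambda>w. g w * of_bool (X w = k)) * s ^ k) =
      expectation (\<lambda>w. of_bool (X w < j) * (g w * s ^ X w))" for j
  proof -
    have "(\<Sum>k<j. expectation (\<lambda>w. g w * of_bool (X w = k)) * s ^ k) =
        (\<Sum>k<j. expectation (\<lambda>w. g w * of_bool (X w = k) * s ^ k))"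
      by simp
    also have "\<dots> = expectation (\<lambda>w. \<Sum>k<j. g w * of_bool (X w = k) * s ^ k)"
      using int by (intro Bochner_Integration.integral_sum [symmetric]) auto
    finally show ?thesis by (simp add: eq)
  qed
  ultimately show ?thesis by (simp add: sums_def)
qed

text \<open>Coefficients are compared in increasing order: once those below \<open>k\<close> agree,
  dividing \<open>A x - B x\<close> by \<open>x ^ k\<close> and letting \<open>x\<close> tend to 0
  isolates the \<open>k\<close>-th difference. The limit is taken from the right because
  \<open>A\<close> and \<open>B\<close> are only known to agree on the unit interval, the range of
  the test functions used later.\<close>

lemma power_series_coeffs_eq:
  fixes a b :: "nat \<Rightarrow> real"
  assumes a: "\<And>x. \<bar>x\<bar> \<le> 1 \<Longrightarrow> (\<lambda>k. a k * x ^ k) sums A x"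
    and b: "\<And>x. \<bar>x\<bar> \<le> 1 \<Longrightarrow> (\<lambda>k. b k * x ^ k) sums B x"
    and AB: "\<And>x. 0 \<le> x \<Longrightarrow> x \<le> 1 \<Longrightarrow> A x = B x"
  shows "a k = b k"
proof (induction k rule: less_induct)
  case (less k)
  let ?f = "\<lambda>x. (A x - B x) / x ^ k"
  have "(?f \<longlongrightarrow> a (0 + k) - b (0 + k)) (at 0)"
  proof (rule powser_limit_0_strong[where s = 1 and a = "\<lambda>i. a (i + k) - b (i + k)"])
    fix x :: real assume x: "x \<noteq> 0" "norm x < 1"
    have "(\<lambda>i. (a i - b i) * x ^ i) sums (A x - B x)"
      using sums_diff[OF a b, of x] x by (simp add: left_diff_distrib)
    then have "(\<lambda>i. (a (i + k) - b (i + k)) * x ^ (i + k)) sums (A x - B x)"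
      by (subst sums_iff_shift) (simp add: less.IH)
    from sums_divide[OF this, of "x ^ k"] x
    show "(\<lambda>i. (a (i + k) - b (i + k)) * x ^ i) sums ?f x"
      by (simp add: power_add)
  qed simp
  then have "(?f \<longlongrightarrow> a k - b k) (at_right 0)"
    by (auto intro: tendsto_within_subset)
  moreover have "(?f \<longlongrightarrow> 0) (at_right 0)"
  proof (rule tendsto_eventually)
    show "\<forall>\<^sub>F x in at_right 0. ?f x = 0"
      using eventually_at_right_less eventually_at_right[of 0 1 "\<lambda>x. x < 1"]
      by (auto simp: AB eventually_at_right_field intro!: exI[of _ 1])
  qed
  ultimately show ?case
    using tendsto_unique[of "at_right (0::real)" ?f] by fastforce
qed

text \<open>Powers are traded for indicators one variable at a time. With the other variables frozen
  in a weight, both sides are power series in the single parameter \<open>s c\<close>, so their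
  coefficients agree; the coefficient of order \<open>k c\<close> is the same expectation with
  \<open>s c ^ X c\<close> replaced by the event \<open>X c = k c\<close>.\<close>

lemma joint_pgf_determines_probabilities:
  fixes X X' :: "'c \<Rightarrow> 'a \<Rightarrow> nat" and M M' :: "'a measure"
  assumes M: "prob_space M" and M': "prob_space M'" and C: "finite C"
    and X: "\<And>c. c \<in> C \<Longrightarrow> X c \<in> measurable M (count_space UNIV)"
    and X': "\<And>c. c \<in> C \<Longrightarrow> X' c \<in> measurable M' (count_space UNIV)"
    and pgf: "\<And>s :: 'c \<Rightarrow> real. (\<And>c. 0 \<le> s c \<and> s c \<le> 1) \<Longrightarrow>
      (\<integral>w. (\<Prod>c\<in>C. s c ^ X c w) \<partial>M) = (\<integral>w. (\<Prod>c\<in>C. s c ^ X' c w) \<partial>M')"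
  shows "measure M {w\<in>space M. \<forall>c\<in>C. X c w = k c} = measure M' {w\<in>space M'. \<forall>c\<in>C. X' c w = k c}"
proof -
  interpret M: prob_space M by fact
  interpret M': prob_space M' by fact
  \<comment> \<open>\<open>D\<close> collects the variables whose power has been removed,
    \<open>D'\<close> those whose indicator has been inserted. The stages of the induction have
    \<open>D = D'\<close>; in the weight \<open>h (insert c D) D\<close> the variable
    \<open>c\<close> occurs in neither form.\<close>
  define h where "h D D' s X w = (\<Prod>c\<in>C - D. s c ^ X c w) * (\<Prod>c\<in>D'. of_bool (X c w = k c))"
    for D D' and s :: "'c \<Rightarrow> real" and X :: "'c \<Rightarrow> 'a \<Rightarrow> nat" and w
  have split: "h D D s X w = h (insert c D) D s X w * s c ^ X c w"
    "h (insert c D) (insert c D) s X w = h (insert c D) D s X w * of_bool (X c w = k c)"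
    if c: "c \<in> C" "c \<notin> D" "D \<subseteq> C" for s D c X w
  proof -
    have "(\<Prod>e\<in>C - D. s e ^ X e w) = s c ^ X c w * (\<Prod>e\<in>C - D - {c}. s e ^ X e w)"
      using c C by (intro prod.remove) auto
    moreover have "C - D - {c} = C - insert c D" by auto
    ultimately show "h D D s X w = h (insert c D) D s X w * s c ^ X c w" by (simp add: h_def)
    have "finite D" using c C finite_subset by auto
    then show "h (insert c D) (insert c D) s X w = h (insert c D) D s X w * of_bool (X c w = k c)"
      using c by (simp add: h_def)
  qed
  have bound: "\<bar>h D D' s X w\<bar> \<le> 1" if s: "\<And>c. 0 \<le> s c \<and> s c \<le> 1" for D D' s X w
  proof -
    have "\<bar>\<Prod>c\<in>C - D. s c ^ X c w\<bar> \<le> 1"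
      unfolding abs_prod using s by (intro prod_le_1) (simp add: power_abs power_le_one)
    moreover have "\<bar>\<Prod>c\<in>D'. of_bool (X c w = k c) :: real\<bar> \<le> 1"
      unfolding abs_prod by (intro prod_le_1) simp
    ultimately show ?thesis unfolding h_def abs_mult by (rule mult_le_one[OF _ abs_ge_zero])
  qed
  have "(\<integral>w. h D D s X w \<partial>M) = (\<integral>w. h D D s X' w \<partial>M')"
    if D: "D \<subseteq> C" and s: "\<And>c. 0 \<le> s c \<and> s c \<le> 1" for D s
    using finite_subset[OF D C] D s
  proof (induction D arbitrary: s rule: finite_induct)
    case empty
    then show ?case using pgf[of s] by (simp add: h_def)
  next
    case (insert c D)
    have c: "c \<in> C" "c \<notin> D" "D \<subseteq> C" using insert by auto
    have m: "h (insert c D) D s X \<in> borel_measurable M" "h (insert c D) D s X' \<in> borel_measurable M'"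
      unfolding h_def using c(3)
      by (intro borel_measurable_times borel_measurable_prod
          measurable_compose[OF X] measurable_compose[OF X'] measurable_count_space; auto)+
    \<comment> \<open>The weight does not see \<open>s c\<close>, so the induction hypothesis,
      general in \<open>s\<close>, lets this parameter run through the unit interval.\<close>
    have upd: "h (insert c D) D (s(c := x)) X w = h (insert c D) D s X w" for x X w
      unfolding h_def by (intro arg_cong2[where f = "(*)"] prod.cong) auto
    have eq: "M.expectation (\<lambda>w. h (insert c D) D s X w * x ^ X c w) =
        M'.expectation (\<lambda>w. h (insert c D) D s X' w * x ^ X' c w)"
      if "0 \<le> x" "x \<le> 1" for x
      using insert.IH[of "s(c := x)"] that insert.prems unfolding split[OF c] upd by simp
    show ?case unfolding split[OF c]
    proof (rule power_series_coeffs_eq)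
      show "(\<lambda>i. M.expectation (\<lambda>w. h (insert c D) D s X w * of_bool (X c w = i)) * x ^ i)
          sums M.expectation (\<lambda>w. h (insert c D) D s X w * x ^ X c w)" if "\<bar>x\<bar> \<le> 1" for x
        using m X[OF c(1)] bound insert.prems that by (intro M.expectation_weighted_power_sums) auto
      show "(\<lambda>i. M'.expectation (\<lambda>w. h (insert c D) D s X' w * of_bool (X' c w = i)) * x ^ i)
          sums M'.expectation (\<lambda>w. h (insert c D) D s X' w * x ^ X' c w)" if "\<bar>x\<bar> \<le> 1" for x
        using m X'[OF c(1)] bound insert.prems that by (intro M'.expectation_weighted_power_sums) auto
    qed (fact eq)
  qed
  from this[of C "\<lambda>_. 1"]
  have "(\<integral>w. (\<Prod>c\<in>C. of_bool (X c w = k c)) \<partial>M) = (\<integral>w. (\<Prod>c\<in>C. of_bool (X' c w = k c)) \<partial>M' :: real)"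
    by (simp add: h_def)
  moreover have "(\<integral>w. (\<Prod>c\<in>C. of_bool (X c w = k c)) \<partial>L :: real) = measure L {w\<in>space L. \<forall>c\<in>C. X c w = k c}"
    for X and L :: "'a measure"
  proof -
    have "(\<Prod>c\<in>C. of_bool (X c w = k c) :: real) = indicator {w. \<forall>c\<in>C. X c w = k c} w" for w
      using C by (auto simp: indicator_def prod_eq_1_iff)
    moreover have "{w. \<forall>c\<in>C. X c w = k c} \<inter> space L = {w\<in>space L. \<forall>c\<in>C. X c w = k c}" by auto
    ultimately show ?thesis by simp
  qed
  ultimately show ?thesis by simp
qed

section \<open>Point configurations\<close>

lemma space_configurations: "space (configurations S) = {A. set_mset A \<subseteq> space S}"
  unfolding configurations_def by (intro space_measure_of) auto

lemma sets_configurations: "sets (configurations S) = sigma_sets {A. set_mset A \<subseteq> space S}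
     {{A. set_mset A \<subseteq> space S \<and> points_in B A = k} | B k. B \<in> sets S}"
  unfolding configurations_def by (intro sets_measure_of) auto

lemma points_in_measurable [measurable]:
  assumes "B \<in> sets S"
  shows "points_in B \<in> measurable (configurations S) (count_space UNIV)"
proof (rule measurable_count_space_eq2_countable[THEN iffD2], safe)
  fix k
  have "points_in B -` {k} \<inter> space (configurations S) = {A. set_mset A \<subseteq> space S \<and> points_in B A = k}"
    by (auto simp: space_configurations)
  also have "\<dots> \<in> sets (configurations S)"
    unfolding sets_configurations using assms by (intro sigma_sets.Basic) auto
  finally show "points_in B -` {k} \<inter> space (configurations S) \<in> sets (configurations S)" .
qed auto

lemma points_in_add_mset: "points_in B (add_mset x A) = of_bool (x \<in> B) + points_in B A"
  by (simp add: points_in_def)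

lemma points_in_empty: "points_in B {#} = 0"
  by (simp add: points_in_def)

lemma measurable_configurationsI:
  assumes "\<And>w. w \<in> space M \<Longrightarrow> set_mset (N w) \<subseteq> space S"
    and m: "\<And>B. B \<in> sets S \<Longrightarrow> (\<lambda>w. points_in B (N w)) \<in> measurable M (count_space UNIV)"
  shows "N \<in> measurable M (configurations S)"
  unfolding configurations_def
proof (rule measurable_measure_of)
  fix y assume "y \<in> {{A. set_mset A \<subseteq> space S \<and> points_in B A = k} | B k. B \<in> sets S}"
  then obtain B k where B: "B \<in> sets S" "y = {A. set_mset A \<subseteq> space S \<and> points_in B A = k}" by auto
  then have "N -` y \<inter> space M = (\<lambda>w. points_in B (N w)) -` {k} \<inter> space M" using assms(1) by auto
  then show "N -` y \<inter> space M \<in> sets M" using measurable_sets[OF m[OF B(1)], of "{k}"] by simp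
qed (use assms(1) in auto)

text \<open>The events given by finitely many count constraints form a generating pi-system. A
  constraint is a triple of component, set and count, so several constraints may concern one
  component, and intersecting two events means uniting their constraint sets.\<close>

lemma configurations_PiM_eqI:
  assumes "prob_space Q" "prob_space R"
    and sQ: "sets Q = sets (PiM I (\<lambda>_. configurations S))" and sR: "sets R = sets (PiM I (\<lambda>_. configurations S))"
    and eq: "\<And>(C :: ('i \<times> 'b set \<times> nat) set). finite C \<Longrightarrow> C \<subseteq> I \<times> sets S \<times> UNIV \<Longrightarrow>
      measure Q {z\<in>space Q. \<forall>c\<in>C. points_in (fst (snd c)) (z (fst c)) = snd (snd c)} =
      measure R {z\<in>space R. \<forall>c\<in>C. points_in (fst (snd c)) (z (fst c)) = snd (snd c)}"
  shows "Q = R"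
proof -
  interpret Q: prob_space Q by fact
  interpret R: prob_space R by fact
  define T where "T = PiM I (\<lambda>_. configurations S)"
  have spQ: "space Q = space T" and spR: "space R = space T"
    using sQ sR by (auto simp: T_def dest: sets_eq_imp_space_eq)
  define F where "F C = {z\<in>space T. \<forall>c\<in>C. points_in (fst (snd c)) (z (fst c)) = snd (snd c)}"
    for C :: "('i \<times> 'b set \<times> nat) set"
  define E where "E = F ` {C. finite C \<and> C \<subseteq> I \<times> sets S \<times> UNIV}"
  have E_sub: "E \<subseteq> Pow (space T)" by (auto simp: E_def F_def)
  have "sigma_sets (space T) E = sets T"
  proof (intro antisym)
    have "E \<subseteq> sets T"
    proof
      fix A assume "A \<in> E"
      then obtain C where C: "finite C" "C \<subseteq> I \<times> sets S \<times> UNIV" "A = F C" by (auto simp: E_def)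
      have "{z\<in>space T. points_in (fst (snd c)) (z (fst c)) = snd (snd c)} \<in> sets T" if "c \<in> C" for c
      proof -
        from that C have [measurable]: "fst (snd c) \<in> sets S" "fst c \<in> I" by auto
        show ?thesis unfolding T_def by measurable
      qed
      then have "{z\<in>space T. \<forall>c\<in>C. points_in (fst (snd c)) (z (fst c)) = snd (snd c)} \<in> sets T"
        using C by (intro sets.sets_Collect_finite_All) auto
      then show "A \<in> sets T" using C by (simp add: F_def)
    qed
    then show "sigma_sets (space T) E \<subseteq> sets T" by (rule sets.sigma_sets_subset)
  next
    have sp: "space (sigma (space T) E) = space T" and se: "sets (sigma (space T) E) = sigma_sets (space T) E"
      using E_sub by (simp_all add: space_measure_of sets_measure_of)
    \<comment> \<open>The generated sigma-algebra contains the product one once the identity map is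
      measurable, which can be checked on components and there on counting maps.\<close>
    have "(\<lambda>z. z) \<in> measurable (sigma (space T) E) T"
      unfolding T_def
    proof (rule measurable_PiM_single')
      fix i assume i: "i \<in> I"
      show "(\<lambda>z. z i) \<in> measurable (sigma (space (PiM I (\<lambda>_. configurations S))) E) (configurations S)"
        unfolding T_def[symmetric]
      proof (rule measurable_configurationsI)
        fix z assume "z \<in> space (sigma (space T) E)"
        then have "z \<in> space T" by (simp add: sp)
        then show "set_mset (z i) \<subseteq> space S" using i by (auto simp: T_def space_PiM PiE_iff space_configurations)
      next
        fix B assume B: "B \<in> sets S"
        show "(\<lambda>z. points_in B (z i)) \<in> measurable (sigma (space T) E) (count_space UNIV)"
        proof (rule measurable_count_space_eq2_countable[THEN iffD2], safe)
          fix k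
          have "(\<lambda>z. points_in B (z i)) -` {k} \<inter> space (sigma (space T) E) = F {(i, B, k)}"
            by (auto simp: F_def sp)
          also have "\<dots> \<in> E" using i B by (auto simp: E_def)
          finally show "(\<lambda>z. points_in B (z i)) -` {k} \<inter> space (sigma (space T) E) \<in> sets (sigma (space T) E)"
            by (simp add: se)
        qed auto
      qed
    qed (auto simp: T_def sp[unfolded T_def] simp flip: space_PiM)
    then show "sets T \<subseteq> sigma_sets (space T) E"
      using measurable_sets[of "\<lambda>z. z" "sigma (space T) E" T] sets.sets_into_space[of _ T]
      by (force simp: sp se Int_absorb2)
  qed
  then have sig: "sets Q = sigma_sets (space T) E" "sets R = sigma_sets (space T) E"
    using sQ sR by (simp_all add: T_def)
  show ?thesis
  proof (rule measure_eqI_generator_eq[where E = E and \<Omega> = "space T" and A = "\<lambda>_. space T"])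
    show "Int_stable E"
    proof (rule Int_stableI)
      fix a b assume "a \<in> E" "b \<in> E"
      then obtain C D where CD: "finite C" "C \<subseteq> I \<times> sets S \<times> UNIV" "a = F C" "finite D" "D \<subseteq> I \<times> sets S \<times> UNIV" "b = F D"
        by (auto simp: E_def)
      then have "a \<inter> b = F (C \<union> D)" by (auto simp: F_def)
      then show "a \<inter> b \<in> E" using CD by (auto simp: E_def)
    qed
    show "emeasure Q X = emeasure R X" if "X \<in> E" for X
      using that eq by (auto simp: E_def F_def Q.emeasure_eq_measure R.emeasure_eq_measure spQ spR)
    show "range (\<lambda>_. space T) \<subseteq> E"
      by (auto simp: E_def F_def intro!: image_eqI[where x = "{}"])
    show "emeasure Q (space T) \<noteq> \<infinity>" by simp
  qed (use E_sub sig in auto)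
qed

section \<open>The generating functional of a Poisson process\<close>

lemma prod_mset_unit_interval:
  fixes v :: "'b \<Rightarrow> real"
  assumes "\<And>y. 0 \<le> v y \<and> v y \<le> 1"
  shows "0 \<le> (\<Prod>y\<in>#A. v y)" "(\<Prod>y\<in>#A. v y) \<le> 1"
proof (induction A)
  case (add y A)
  { case 1 show ?case using add assms[of y] by simp }
  { case 2 show ?case using add assms[of y] by (simp add: mult_le_one) }
qed auto

lemma tendsto_prod_mset:
  fixes V :: "nat \<Rightarrow> 'b \<Rightarrow> real"
  assumes "\<And>y. (\<lambda>k. V k y) \<longlonglongrightarrow> v y"
  shows "(\<lambda>k. \<Prod>y\<in>#A. V k y) \<longlonglongrightarrow> (\<Prod>y\<in>#A. v y)"
  by (induction A) (auto intro!: tendsto_mult assms)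

text \<open>Atoms are grouped by the value of \<open>v\<close>. This turns a functional of the
  configuration into powers of counts on disjoint level sets, which the Poisson property describes
  directly.\<close>

lemma prod_mset_simple_function:
  fixes v :: "'b \<Rightarrow> real"
  assumes v: "simple_function S v" and A: "set_mset A \<subseteq> space S"
  shows "(\<Prod>y\<in>#A. v y) = (\<Prod>c\<in>v ` space S. c ^ points_in (v -` {c} \<inter> space S) A)"
  using A
proof (induction A)
  case (add y A)
  have "(\<Prod>c\<in>v ` space S. c ^ of_bool (y \<in> v -` {c} \<inter> space S)) = (\<Prod>c\<in>v ` space S. if c = v y then v y else 1)"
    using add.prems by (intro prod.cong) auto
  also have "\<dots> = v y"
    using add.prems simple_functionD(1)[OF v] by (subst prod.delta) auto
  finally show ?case using add by (simp add: points_in_add_mset power_add prod.distrib)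
qed (simp add: points_in_empty)

lemma borel_measurable_real_approx:
  fixes v :: "'b \<Rightarrow> real"
  assumes "v \<in> borel_measurable S" "\<And>y. 0 \<le> v y \<and> v y \<le> 1"
  obtains V where "\<And>k. simple_function S (V k)" "\<And>k y. 0 \<le> V k y \<and> V k y \<le> 1"
    "\<And>y. (\<lambda>k. V k y) \<longlonglongrightarrow> v y"
proof -
  obtain V where V: "\<And>k. simple_function S (V k)" "incseq V" "\<And>y. bdd_above (range (\<lambda>k. V k y))"
    "\<And>k y. 0 \<le> V k y" "v = (SUP k. V k)"
    using borel_measurable_implies_simple_function_sequence_real[of v S] assms by metis
  have v: "v y = (SUP k. V k y)" for y by (simp add: V(5) image_image)
  have lim: "(\<lambda>k. V k y) \<longlonglongrightarrow> v y" for y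
    unfolding v using V(2,3) by (intro LIMSEQ_incseq_SUP) (auto simp: incseq_def le_fun_def)
  have "V k y \<le> v y" for k y unfolding v using V(3) by (intro cSUP_upper) auto
  then have "V k y \<le> 1" for k y using assms(2) order_trans by blast
  then show ?thesis using that[OF V(1) _ lim] V(4) by auto
qed

text \<open>The sigma-algebra is generated by counts, so measurability is first seen for simple
  functions, where the product is a function of finitely many counts, and then passes to pointwise
  limits.\<close>

lemma prod_mset_measurable:
  fixes v :: "'b \<Rightarrow> real"
  assumes "v \<in> borel_measurable S" "\<And>y. 0 \<le> v y \<and> v y \<le> 1"
  shows "(\<lambda>A. \<Prod>y\<in>#A. v y) \<in> borel_measurable (configurations S)"
proof -
  obtain V where V: "\<And>k. simple_function S (V k)" "\<And>y. (\<lambda>k. V k y) \<longlonglongrightarrow> v y"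
    using borel_measurable_real_approx[OF assms] by metis
  have "(\<lambda>A. \<Prod>y\<in>#A. V k y) \<in> borel_measurable (configurations S)" for k
  proof -
    have "(\<lambda>A. \<Prod>c\<in>V k ` space S. c ^ points_in (V k -` {c} \<inter> space S) A) \<in> borel_measurable (configurations S)"
      using simple_functionD(2)[OF V(1), of k]
      by (intro borel_measurable_prod measurable_compose[OF points_in_measurable]) auto
    then show ?thesis
      by (rule measurable_cong[THEN iffD1, rotated])
         (simp add: prod_mset_simple_function[OF V(1)] space_configurations)
  qed
  then show ?thesis
  proof (rule borel_measurable_LIMSEQ_real[rotated])
    show "(\<lambda>k. \<Prod>y\<in>#A. V k y) \<longlonglongrightarrow> (\<Prod>y\<in>#A. v y)" for A
      by (intro tendsto_prod_mset V(2))
  qed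
qed

text \<open>The counts on the level sets of \<open>v\<close> are independent Poisson variables with
  means \<open>measure L (B i)\<close>, and a Poisson variable of mean \<open>a\<close> has
  generating function \<open>exp ((h - 1) * a)\<close> at \<open>h\<close>. The exponents add up to
  the integral of \<open>v - 1\<close>.\<close>

lemma (in prob_space) poisson_functional_simple:
  fixes v :: "'b \<Rightarrow> real"
  assumes poisson: "poisson_point_process M L N"
    and v: "simple_function L v" "\<And>y. 0 \<le> v y \<and> v y \<le> 1"
  shows "expectation (\<lambda>w. \<Prod>y\<in>#N w. v y) = exp (\<integral>y. v y - 1 \<partial>L)"
proof -
  interpret L: finite_measure L using poisson by (simp add: poisson_point_process_def)
  have N: "N \<in> measurable M (configurations L)"
    and pmf: "\<And>B k. B \<in> sets L \<Longrightarrow> prob {w \<in> space M. points_in B (N w) = k} =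
        measure L B ^ k / fact k * exp (- measure L B)"
    using poisson by (auto simp: poisson_point_process_def)
  \<comment> \<open>The values of \<open>v\<close> are numbered because the independence clause of
    \<open>poisson_point_process\<close> is about families indexed by natural numbers.\<close>
  obtain h where h: "bij_betw h {0..<card (v ` space L)} (v ` space L)"
    using ex_bij_betw_nat_finite[OF simple_functionD(1)[OF v(1)]] by auto
  define I where "I = {0..<card (v ` space L)}"
  define B where "B i = v -` {h i} \<inter> space L" for i
  have B[measurable]: "B i \<in> sets L" for i using simple_functionD(2)[OF v(1)] by (auto simp: B_def)
  have h01: "0 \<le> h i \<and> h i \<le> 1" if "i \<in> I" for i
  proof -
    have "h i \<in> v ` space L" using h that by (auto simp: bij_betw_def I_def)
    then show ?thesis using v(2) by auto
  qed
  have "disjoint_family_on B I"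
    using h by (auto simp: disjoint_family_on_def B_def I_def bij_betw_def inj_on_def)
  then have indep: "indep_vars (\<lambda>_. count_space UNIV) (\<lambda>i w. points_in (B i) (N w)) I"
    using poisson B unfolding poisson_point_process_def by (auto simp: I_def image_subset_iff)
  have "indep_vars (\<lambda>_. borel) (\<lambda>i. (\<lambda>k. h i ^ k) \<circ> (\<lambda>w. points_in (B i) (N w))) I"
    by (rule indep_vars_compose[OF indep]) auto
  then have ind: "indep_vars (\<lambda>_. borel) (\<lambda>i w. h i ^ points_in (B i) (N w)) I"
    by (simp add: comp_def)
  have X: "(\<lambda>w. points_in (B i) (N w)) \<in> measurable M (count_space UNIV)" for i
    using measurable_compose[OF N points_in_measurable[OF B]] .
  have E: "expectation (\<lambda>w. h i ^ points_in (B i) (N w)) = exp ((h i - 1) * measure L (B i))"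
    if "i \<in> I" for i
  proof -
    have "(\<lambda>k. expectation (\<lambda>w. 1 * of_bool (points_in (B i) (N w) = k)) * h i ^ k)
        sums expectation (\<lambda>w. 1 * h i ^ points_in (B i) (N w))"
      using X h01[OF that] by (intro expectation_weighted_power_sums) auto
    moreover have "expectation (\<lambda>w. 1 * of_bool (points_in (B i) (N w) = k)) =
        measure L (B i) ^ k / fact k * exp (- measure L (B i))" for k
    proof -
      have "expectation (\<lambda>w. of_bool (points_in (B i) (N w) = k)) =
          expectation (indicator {w \<in> space M. points_in (B i) (N w) = k})"
        by (intro Bochner_Integration.integral_cong) (auto simp: indicator_def)
      also have "\<dots> = prob {w \<in> space M. points_in (B i) (N w) = k}"
        by (simp add: Int_absorb2 subset_eq)
      finally show ?thesis using pmf[OF B] by simp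
    qed
    ultimately have "(\<lambda>k. measure L (B i) ^ k / fact k * exp (- measure L (B i)) * h i ^ k)
        sums expectation (\<lambda>w. h i ^ points_in (B i) (N w))" by simp
    moreover have "(\<lambda>k. exp (- measure L (B i)) * ((h i * measure L (B i)) ^ k /\<^sub>R fact k))
        sums (exp (- measure L (B i)) * exp (h i * measure L (B i)))"
      by (intro sums_mult exp_converges)
    ultimately have "expectation (\<lambda>w. h i ^ points_in (B i) (N w)) =
        exp (- measure L (B i)) * exp (h i * measure L (B i))"
      by (intro sums_unique2[where f = "\<lambda>k. measure L (B i) ^ k / fact k * exp (- measure L (B i)) * h i ^ k"])
         (auto simp: field_simps power_mult_distrib)
    then show ?thesis by (simp add: exp_add[symmetric] algebra_simps)
  qed
  have eq: "(\<Prod>y\<in>#N w. v y) = (\<Prod>i\<in>I. h i ^ points_in (B i) (N w))" if "w \<in> space M" for w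
  proof -
    have "set_mset (N w) \<subseteq> space L"
      using measurable_space[OF N that] by (simp add: space_configurations)
    from prod_mset_simple_function[OF v(1) this] show ?thesis
      by (simp add: prod.reindex_bij_betw[OF h, symmetric] B_def I_def)
  qed
  have "expectation (\<lambda>w. \<Prod>y\<in>#N w. v y) = expectation (\<lambda>w. \<Prod>i\<in>I. h i ^ points_in (B i) (N w))"
    by (intro Bochner_Integration.integral_cong) (auto simp: eq)
  also have "\<dots> = (\<Prod>i\<in>I. expectation (\<lambda>w. h i ^ points_in (B i) (N w)))"
  proof (rule indep_vars_lebesgue_integral[OF _ ind])
    show "integrable M (\<lambda>w. h i ^ points_in (B i) (N w))" if "i \<in> I" for i
      using measurable_compose[OF X, of "\<lambda>k. h i ^ k" borel] h01[OF that]
      by (intro integrable_const_bound[where B = 1]) (auto simp: power_le_one)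
  qed (simp add: I_def)
  also have "\<dots> = exp (\<Sum>i\<in>I. (h i - 1) * measure L (B i))"
    by (simp add: E exp_sum I_def)
  also have "(\<Sum>i\<in>I. (h i - 1) * measure L (B i)) = (\<integral>y. (\<Sum>i\<in>I. (h i - 1) * indicator (B i) y) \<partial>L)"
    by (subst Bochner_Integration.integral_sum) (auto simp: L.emeasure_eq_measure Int_absorb2 sets.sets_into_space)
  also have "\<dots> = (\<integral>y. v y - 1 \<partial>L)"
  proof (intro Bochner_Integration.integral_cong refl)
    fix y assume y: "y \<in> space L"
    have "(\<Sum>i\<in>I. (h i - 1) * indicator (B i) y) = (\<Sum>i\<in>I. (\<lambda>c. (c - 1) * of_bool (v y = c)) (h i))"
      using y by (intro sum.cong) (auto simp: B_def indicator_def)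
    also have "\<dots> = (\<Sum>c\<in>v ` space L. (c - 1) * of_bool (v y = c))"
      unfolding I_def by (rule sum.reindex_bij_betw[OF h])
    also have "\<dots> = (\<Sum>c\<in>v ` space L. if c = v y then v y - 1 else 0)" by (intro sum.cong) auto
    also have "\<dots> = v y - 1" using y simple_functionD(1)[OF v(1)] by (subst sum.delta) auto
    finally show "(\<Sum>i\<in>I. (h i - 1) * indicator (B i) y) = v y - 1" .
  qed
  finally show ?thesis .
qed

text \<open>Simple functions with values in the unit interval converge to \<open>v\<close>
  pointwise. Both sides pass to the limit with the constant 1 as dominating function, on the right
  because \<open>L\<close> is finite.\<close>

lemma (in prob_space) poisson_functional:
  fixes v :: "'b \<Rightarrow> real"
  assumes poisson: "poisson_point_process M L N"
    and v: "v \<in> borel_measurable L" "\<And>y. 0 \<le> v y \<and> v y \<le> 1"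
  shows "expectation (\<lambda>w. \<Prod>y\<in>#N w. v y) = exp (\<integral>y. v y - 1 \<partial>L)"
proof -
  interpret L: finite_measure L using poisson by (simp add: poisson_point_process_def)
  have N: "N \<in> measurable M (configurations L)" using poisson by (simp add: poisson_point_process_def)
  obtain V where V: "\<And>k. simple_function L (V k)" "\<And>k y. 0 \<le> V k y \<and> V k y \<le> 1"
    "\<And>y. (\<lambda>k. V k y) \<longlonglongrightarrow> v y"
    using borel_measurable_real_approx[OF v] by metis
  have Vm: "V k \<in> borel_measurable L" for k using V(1) by (rule borel_measurable_simple_function)
  have "(\<lambda>k. expectation (\<lambda>w. \<Prod>y\<in>#N w. V k y)) \<longlonglongrightarrow> expectation (\<lambda>w. \<Prod>y\<in>#N w. v y)"
  proof (rule integral_dominated_convergence[where w = "\<lambda>_. 1"])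
    show "(\<lambda>w. \<Prod>y\<in>#N w. v y) \<in> borel_measurable M"
      using measurable_compose[OF N prod_mset_measurable[OF v]] .
    show "(\<lambda>w. \<Prod>y\<in>#N w. V k y) \<in> borel_measurable M" for k
      using measurable_compose[OF N prod_mset_measurable[OF Vm V(2)]] .
    show "AE w in M. (\<lambda>k. \<Prod>y\<in>#N w. V k y) \<longlonglongrightarrow> (\<Prod>y\<in>#N w. v y)"
      by (intro AE_I2 tendsto_prod_mset V(3))
    show "AE w in M. norm (\<Prod>y\<in>#N w. V k y) \<le> 1" for k
      using prod_mset_unit_interval[of "V k"] V(2) by (auto simp: abs_le_iff intro: order_trans[of _ 0])
  qed simp
  moreover have "(\<lambda>k. exp (\<integral>y. V k y - 1 \<partial>L)) \<longlonglongrightarrow> exp (\<integral>y. v y - 1 \<partial>L)"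
  proof (intro tendsto_exp integral_dominated_convergence[where w = "\<lambda>_. 1"])
    show "AE y in L. (\<lambda>k. V k y - 1) \<longlonglongrightarrow> v y - 1" by (intro AE_I2 tendsto_diff V(3) tendsto_const)
    show "AE y in L. norm (V k y - 1) \<le> 1" for k using V(2) by auto
  qed (use v(1) Vm in auto)
  ultimately show ?thesis
    using LIMSEQ_unique by (simp add: poisson_functional_simple[OF poisson V(1,2)]) blast
qed

section \<open>The law of the displaced processes\<close>

lemma points_in_image_mset:
  fixes k :: nat
  shows "points_in B (image_mset g (mset_set {..<k})) = (\<Sum>j<k. of_bool (g j \<in> B))"
  by (induction k) (simp_all add: points_in_add_mset points_in_empty lessThan_Suc)

lemma prod_image_mset_lessThan:
  fixes k :: nat
  shows "(\<Prod>y\<in>#image_mset g (mset_set {..<k}). v y) = (\<Prod>j<k. v (g j))"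
  by (simp add: prod_unfold_prod_mset image_mset.compositionality comp_def)

lemma frac_measurable_circle [measurable]:
  assumes "g \<in> borel_measurable M"
  shows "(\<lambda>w. frac (g w)) \<in> measurable M circle"
proof (rule measurable_restrict_space2)
  show "(\<lambda>w. frac (g w)) \<in> measurable M lborel"
    using assms unfolding frac_def by simp
qed (auto simp: frac_lt_1)

lemma measurable_circle_borel:
  assumes "g \<in> measurable M circle"
  shows "g \<in> borel_measurable M"
  using measurable_compose[OF assms, of "\<lambda>t. t" borel] by (simp add: measurable_restrict_space1)

text \<open>A non-integrable function has integral 0 by convention, and this value lies in the
  interval as well.\<close>

lemma (in prob_space) integral_unit_interval:
  fixes g :: "'a \<Rightarrow> real"
  assumes "\<And>w. 0 \<le> g w \<and> g w \<le> 1"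
  shows "0 \<le> integral\<^sup>L M g \<and> integral\<^sup>L M g \<le> 1"
proof (cases "integrable M g")
  case True
  then show ?thesis using assms integral_le_const[OF True, of 1] by auto
qed (simp add: not_integrable_integral_eq)

text \<open>Translates the form in which the model expresses independence, between generated
  sigma-algebras, into a product law, to which Fubini's theorem applies.\<close>

lemma (in prob_space) indep_set_joint_distr:
  assumes U: "U \<in> measurable M A" and V: "V \<in> measurable M B"
    and ind: "indep_set (sets (vimage_algebra (space M) U A)) (sets (vimage_algebra (space M) V B))"
  shows "distr M (A \<Otimes>\<^sub>M B) (\<lambda>w. (U w, V w)) = distr M A U \<Otimes>\<^sub>M distr M B V"
proof (rule pair_measure_eqI[symmetric])
  show "sigma_finite_measure (distr M A U)" "sigma_finite_measure (distr M B V)"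
    using prob_space_distr[OF U] prob_space_distr[OF V]
    by (auto intro: prob_space_imp_sigma_finite)
  fix X Z assume X: "X \<in> sets (distr M A U)" and Z: "Z \<in> sets (distr M B V)"
  have "prob ((U -` X \<inter> space M) \<inter> (V -` Z \<inter> space M)) = prob (U -` X \<inter> space M) * prob (V -` Z \<inter> space M)"
    using X Z by (intro indep_setD[OF ind] in_vimage_algebra) auto
  moreover have "(\<lambda>w. (U w, V w)) -` (X \<times> Z) \<inter> space M = (U -` X \<inter> space M) \<inter> (V -` Z \<inter> space M)" by auto
  moreover have "X \<times> Z \<in> sets (A \<Otimes>\<^sub>M B)" using X Z by simp
  ultimately show "emeasure (distr M A U) X * emeasure (distr M B V) Z =
      emeasure (distr M (A \<Otimes>\<^sub>M B) (\<lambda>w. (U w, V w))) (X \<times> Z)"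
    using U V X Z by (simp add: emeasure_distr emeasure_eq_measure ennreal_mult[symmetric])
qed (simp cong: sets_pair_measure_cong)

text \<open>The mean of \<open>u\<close> at a point displaced from \<open>y\<close> by the noise.
  Integrating it against an intensity amounts to integrating \<open>u\<close> against the circular
  convolution of that intensity with \<open>f\<close>.\<close>

definition smoothed :: "(real \<Rightarrow> real) \<Rightarrow> (real \<Rightarrow> real) \<Rightarrow> real \<Rightarrow> real" where
  "smoothed f u y = (\<integral>e. u (frac (y + e)) \<partial>density circle (\<lambda>t. ennreal (f t)))"

context shifted_poisson_model
begin

lemma noise_measurable: "i \<in> {1..n} \<Longrightarrow> \<epsilon> i j \<in> measurable P circle"
  using noise_density by (simp add: distributed_def)

lemma noise_distr:
  "i \<in> {1..n} \<Longrightarrow> distr P circle (\<epsilon> i j) = density circle (\<lambda>t. ennreal (f t))"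
  using noise_density by (simp add: distributed_def)

lemma displaced_point_measurable:
  "i \<in> {1..n} \<Longrightarrow> (\<lambda>w. frac (x i j w + \<epsilon> i j w)) \<in> measurable P circle"
  using x_measurable noise_measurable
  by (intro frac_measurable_circle borel_measurable_add) (auto intro: measurable_circle_borel)

lemma observed_measurable:
  assumes i: "i \<in> {1..n}"
  shows "N i \<in> measurable P (configurations circle)"
proof (rule measurable_configurationsI)
  fix w assume "w \<in> space P"
  then show "set_mset (N i w) \<subseteq> space circle"
    using observed[OF i] by (auto simp: frac_lt_1)
next
  fix B :: "real set" assume [measurable]: "B \<in> sets circle"
  note [measurable] = displaced_point_measurable[OF i] K_measurable[OF i]
  have "(\<lambda>w. \<Sum>j<k. of_bool (frac (x i j w + \<epsilon> i j w) \<in> B) :: nat) \<in> measurable P (count_space UNIV)" for k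
    by measurable
  then have "(\<lambda>w. \<Sum>j<K i w. of_bool (frac (x i j w + \<epsilon> i j w) \<in> B) :: nat) \<in> measurable P (count_space UNIV)"
    by (rule measurable_compose_countable) measurable
  then show "(\<lambda>w. points_in B (N i w)) \<in> measurable P (count_space UNIV)"
    by (rule measurable_cong[THEN iffD1, rotated]) (simp add: observed[OF i] points_in_image_mset)
qed

lemma observed_vector_measurable:
  "(\<lambda>w. \<lambda>i\<in>{1..n}. N i w) \<in> measurable P (PiM {1..n} (\<lambda>_. configurations circle))"
  by (intro measurable_restrict observed_measurable)

text \<open>That \<open>f\<close> integrates to 1 is inferred from the law of an actual noise
  variable, hence the condition on \<open>n\<close>.\<close>

lemma noise_prob_space: "n \<ge> 1 \<Longrightarrow> prob_space (density circle (\<lambda>t. ennreal (f t)))"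
  using prob_space_distr[OF noise_measurable[of 1 0]] noise_distr[of 1 0] by simp

text \<open>The inner integral of the next computation: counts and hidden points are frozen numbers
  \<open>k i\<close> and \<open>a i j\<close>. Every displaced point has its own noise variable, so
  the expectation factorizes over the pairs \<open>(i, j)\<close>.\<close>

lemma expectation_noise_product:
  assumes u: "\<And>i. u i \<in> borel_measurable circle" "\<And>i y. 0 \<le> u i y \<and> u i y \<le> (1 :: real)"
  shows "expectation (\<lambda>w. \<Prod>i\<in>{1..n}. \<Prod>j<k i. u i (frac (a i j + \<epsilon> i j w))) =
    (\<Prod>i\<in>{1..n}. \<Prod>j<k i. smoothed f (u i) (a i j))"
proof -
  define J where "J = (SIGMA i:{1..n}. {..<k i})"
  have J: "finite J" "J \<subseteq> {1..n} \<times> UNIV" by (auto simp: J_def)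
  define F where "F ij e = u (fst ij) (frac (a (fst ij) (snd ij) + e))" for ij e
  have F[measurable]: "F ij \<in> borel_measurable circle" for ij
    unfolding F_def by (intro measurable_compose[OF frac_measurable_circle u(1)]) (simp add: measurable_restrict_space1)
  have "indep_vars (\<lambda>_. circle) (\<lambda>(i, j). \<epsilon> i j) J"
    using noise_indep J(2) by (rule indep_vars_subset)
  then have "indep_vars (\<lambda>_. borel) (\<lambda>ij. F ij \<circ> (case ij of (i, j) \<Rightarrow> \<epsilon> i j)) J"
    by (rule indep_vars_compose) simp
  then have ind: "indep_vars (\<lambda>_. borel) (\<lambda>ij w. F ij (\<epsilon> (fst ij) (snd ij) w)) J"
    by (simp add: comp_def case_prod_unfold)
  have eps: "\<epsilon> (fst ij) (snd ij) \<in> measurable P circle" if "ij \<in> J" for ij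
    using that J(2) by (intro noise_measurable) auto
  have "expectation (\<lambda>w. \<Prod>i\<in>{1..n}. \<Prod>j<k i. u i (frac (a i j + \<epsilon> i j w))) =
      expectation (\<lambda>w. \<Prod>ij\<in>J. F ij (\<epsilon> (fst ij) (snd ij) w))"
    by (simp add: J_def prod.Sigma F_def case_prod_unfold)
  also have "\<dots> = (\<Prod>ij\<in>J. expectation (\<lambda>w. F ij (\<epsilon> (fst ij) (snd ij) w)))"
  proof (rule indep_vars_lebesgue_integral[OF J(1) ind])
    show "integrable P (\<lambda>w. F ij (\<epsilon> (fst ij) (snd ij) w))" if "ij \<in> J" for ij
      using u(2) measurable_compose[OF eps[OF that] F]
      by (intro integrable_const_bound[where B = 1]) (auto simp: F_def)
  qed
  also have "\<dots> = (\<Prod>ij\<in>J. smoothed f (u (fst ij)) (a (fst ij) (snd ij)))"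
  proof (rule prod.cong)
    fix ij assume ij: "ij \<in> J"
    have "expectation (\<lambda>w. F ij (\<epsilon> (fst ij) (snd ij) w)) = (\<integral>e. F ij e \<partial>distr P circle (\<epsilon> (fst ij) (snd ij)))"
      using eps[OF ij] by (simp add: integral_distr)
    also have "\<dots> = smoothed f (u (fst ij)) (a (fst ij) (snd ij))"
      using ij by (subst noise_distr) (auto simp: J_def smoothed_def F_def[abs_def])
    finally show "expectation (\<lambda>w. F ij (\<epsilon> (fst ij) (snd ij) w)) = smoothed f (u (fst ij)) (a (fst ij) (snd ij))" .
  qed simp
  also have "\<dots> = (\<Prod>i\<in>{1..n}. \<Prod>j<k i. smoothed f (u i) (a i j))"
    by (simp add: J_def prod.Sigma case_prod_unfold)
  finally show ?thesis .
qed

text \<open>Conditioning on the hidden data by Fubini's theorem. The hidden data \<open>U\<close>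
  and the noise \<open>V\<close> have a product joint law, so for fixed counts and enumerated points
  the noise is integrated out first.\<close>

lemma expectation_displaced_product:
  assumes u: "\<And>i. u i \<in> borel_measurable circle" "\<And>i y. 0 \<le> u i y \<and> u i y \<le> (1 :: real)"
  shows "expectation (\<lambda>w. \<Prod>i\<in>{1..n}. \<Prod>y\<in>#N i w. u i y) =
    expectation (\<lambda>w. \<Prod>i\<in>{1..n}. \<Prod>y\<in>#image_mset (\<lambda>j. x i j w) (mset_set {..<K i w}). smoothed f (u i) y)"
proof -
  let ?A = "PiM {1..n} (\<lambda>_. count_space (UNIV :: nat set) \<Otimes>\<^sub>M PiM (UNIV :: nat set) (\<lambda>_. circle))"
  let ?B = "PiM ({1..n} \<times> (UNIV :: nat set)) (\<lambda>_. circle)"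
  define U where "U w = (\<lambda>i\<in>{1..n}. (K i w, \<lambda>j. x i j w))" for w
  define V where "V w = (\<lambda>(i, j)\<in>{1..n} \<times> UNIV. \<epsilon> i j w)" for w
  define h where "h a b = (\<Prod>i\<in>{1..n}. \<Prod>j<fst (a i). u i (frac (snd (a i) j + b (i, j))))"
    for a :: "nat \<Rightarrow> nat \<times> (nat \<Rightarrow> real)" and b
  have U[measurable]: "U \<in> measurable P ?A"
    unfolding U_def
  proof (intro measurable_restrict measurable_Pair)
    show "(\<lambda>w j. x i j w) \<in> measurable P (PiM UNIV (\<lambda>_. circle))" if "i \<in> {1..n}" for i
      by (rule measurable_PiM_single')
         (use x_measurable[OF that] measurable_space[OF x_measurable[OF that]] in auto)
  qed (rule K_measurable)
  have V[measurable]: "V \<in> measurable P ?B"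
    unfolding V_def case_prod_unfold
    by (intro measurable_restrict) (auto intro: noise_measurable)
  have joint: "distr P (?A \<Otimes>\<^sub>M ?B) (\<lambda>w. (U w, V w)) = distr P ?A U \<Otimes>\<^sub>M distr P ?B V"
    using noise_indep_hidden
    by (intro indep_set_joint_distr U V) (simp add: U_def[abs_def] V_def[abs_def])
  interpret U: prob_space "distr P ?A U" using U by (rule prob_space_distr)
  interpret V: prob_space "distr P ?B V" using V by (rule prob_space_distr)
  interpret UV: pair_prob_space "distr P ?A U" "distr P ?B V" ..
  have hm[measurable]: "(\<lambda>(a, b). h a b) \<in> borel_measurable (?A \<Otimes>\<^sub>M ?B)"
    unfolding h_def case_prod_unfold
  proof (rule borel_measurable_prod)
    fix i assume i: "i \<in> {1..n}"
    have [measurable]: "(\<lambda>ab. fst ab i) \<in> measurable (?A \<Otimes>\<^sub>M ?B) (count_space UNIV \<Otimes>\<^sub>M PiM UNIV (\<lambda>_. circle))"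
      using i by measurable
    have c: "(\<lambda>ab. snd (fst ab i) j) \<in> borel_measurable (?A \<Otimes>\<^sub>M ?B)" for j
      by (rule measurable_circle_borel) measurable
    have d: "(\<lambda>ab. snd ab (i, j)) \<in> borel_measurable (?A \<Otimes>\<^sub>M ?B)" for j
      using i by (intro measurable_circle_borel measurable_compose[OF measurable_snd measurable_component_singleton]) auto
    \<comment> \<open>The number of factors is itself random: measurability is shown for each fixed
      number \<open>k\<close>, and the countably many cases are then glued.\<close>
    have "(\<lambda>ab. \<Prod>j<k. u i (frac (snd (fst ab i) j + snd ab (i, j)))) \<in> borel_measurable (?A \<Otimes>\<^sub>M ?B)" for k
      by (intro borel_measurable_prod measurable_compose[OF frac_measurable_circle u(1)] borel_measurable_add c d)
    then show "(\<lambda>ab. \<Prod>j<fst (fst ab i). u i (frac (snd (fst ab i) j + snd ab (i, j)))) \<in> borel_measurable (?A \<Otimes>\<^sub>M ?B)"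
      by (rule measurable_compose_countable) measurable
  qed
  have h1: "\<bar>h a b\<bar> \<le> 1" for a b
    unfolding h_def abs_prod using u(2) by (intro prod_le_1) (auto intro!: prod_nonneg prod_le_1)
  have sm: "(\<integral>b. h (U w) b \<partial>distr P ?B V) =
      (\<Prod>i\<in>{1..n}. \<Prod>y\<in>#image_mset (\<lambda>j. x i j w) (mset_set {..<K i w}). smoothed f (u i) y)"
    if w: "w \<in> space P" for w
  proof -
    have "U w \<in> space ?A" using measurable_space[OF U w] .
    then have "(\<lambda>b. h (U w) b) \<in> borel_measurable ?B"
      using measurable_compose[OF measurable_Pair1' hm] by simp
    then have "(\<integral>b. h (U w) b \<partial>distr P ?B V) = expectation (\<lambda>w'. h (U w) (V w'))"
      by (rule integral_distr[OF V])
    also have "\<dots> = expectation (\<lambda>w'. \<Prod>i\<in>{1..n}. \<Prod>j<K i w. u i (frac (x i j w + \<epsilon> i j w')))"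
      by (intro Bochner_Integration.integral_cong) (auto simp: h_def U_def V_def intro!: prod.cong)
    also have "\<dots> = (\<Prod>i\<in>{1..n}. \<Prod>j<K i w. smoothed f (u i) (x i j w))"
      using u by (rule expectation_noise_product)
    finally show ?thesis unfolding prod_image_mset_lessThan .
  qed
  have "expectation (\<lambda>w. \<Prod>i\<in>{1..n}. \<Prod>y\<in>#N i w. u i y) = expectation (\<lambda>w. h (U w) (V w))"
  proof (intro Bochner_Integration.integral_cong refl)
    fix w assume w: "w \<in> space P"
    have "(\<Prod>y\<in>#N i w. u i y) = (\<Prod>j<K i w. u i (frac (x i j w + \<epsilon> i j w)))" if "i \<in> {1..n}" for i
      unfolding observed[OF that w] by (rule prod_image_mset_lessThan)
    then show "(\<Prod>i\<in>{1..n}. \<Prod>y\<in>#N i w. u i y) = h (U w) (V w)"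
      by (auto simp: h_def U_def V_def intro!: prod.cong)
  qed
  also have "\<dots> = (\<integral>(a, b). h a b \<partial>distr P (?A \<Otimes>\<^sub>M ?B) (\<lambda>w. (U w, V w)))"
    by (subst integral_distr[OF measurable_Pair[OF U V] hm]) simp
  also have "\<dots> = (\<integral>a. (\<integral>b. h a b \<partial>distr P ?B V) \<partial>distr P ?A U)"
    unfolding joint
  proof (subst UV.integral_fst'[symmetric])
    show "integrable (distr P ?A U \<Otimes>\<^sub>M distr P ?B V) (\<lambda>(a, b). h a b)"
    proof (rule UV.P.integrable_const_bound[where B = 1])
      show "(\<lambda>(a, b). h a b) \<in> borel_measurable (distr P ?A U \<Otimes>\<^sub>M distr P ?B V)"
        by (subst measurable_cong_sets[OF sets_pair_measure_cong[OF sets_distr sets_distr] refl]) (rule hm)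
    qed (use h1 in \<open>simp add: case_prod_unfold\<close>)
  qed simp
  also have "\<dots> = expectation (\<lambda>w. \<integral>b. h (U w) b \<partial>distr P ?B V)"
    by (rule integral_distr[OF U]) measurable
  also have "\<dots> = expectation (\<lambda>w. \<Prod>i\<in>{1..n}. \<Prod>y\<in>#image_mset (\<lambda>j. x i j w) (mset_set {..<K i w}). smoothed f (u i) y)"
    by (intro Bochner_Integration.integral_cong refl sm)
  finally show ?thesis .
qed

lemma generating_functional_observed:
  assumes n: "n \<ge> 1"
    and u: "\<And>i. u i \<in> borel_measurable circle" "\<And>i y. 0 \<le> u i y \<and> u i y \<le> (1 :: real)"
  shows "expectation (\<lambda>w. \<Prod>i\<in>{1..n}. \<Prod>y\<in>#N i w. u i y) =
    (\<Prod>i\<in>{1..n}. exp (\<integral>y. smoothed f (u i) y - 1 \<partial>density circle (\<lambda>t. ennreal (lam t))))"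
proof -
  interpret f: prob_space "density circle (\<lambda>t. ennreal (f t))" using n by (rule noise_prob_space)
  have v: "0 \<le> smoothed f (u i) y \<and> smoothed f (u i) y \<le> 1" for i y
    unfolding smoothed_def using u(2) by (intro f.integral_unit_interval)
  have vm: "smoothed f (u i) \<in> borel_measurable circle" for i
    unfolding smoothed_def
  proof (rule f.borel_measurable_lebesgue_integral)
    have "(\<lambda>(y, e). u i (frac (y + e))) \<in> borel_measurable (circle \<Otimes>\<^sub>M circle)"
      unfolding case_prod_unfold
      by (intro measurable_compose[OF frac_measurable_circle u(1)] borel_measurable_add
          measurable_circle_borel[OF measurable_fst] measurable_circle_borel[OF measurable_snd])
    then show "(\<lambda>(y, e). u i (frac (y + e))) \<in> borel_measurable (circle \<Otimes>\<^sub>M density circle (\<lambda>t. ennreal (f t)))"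
      by (subst measurable_cong_sets[OF sets_pair_measure_cong[OF refl sets_density] refl])
  qed
  let ?H = "\<lambda>i w. image_mset (\<lambda>j. x i j w) (mset_set {..<K i w})"
  note ind = indep_vars_compose[OF hidden_indep, of "\<lambda>i A. \<Prod>y\<in>#A. smoothed f (u i) y" "\<lambda>_. borel",
      OF prod_mset_measurable[OF vm v]]
  then have ind: "indep_vars (\<lambda>_. borel) (\<lambda>i w. \<Prod>y\<in>#?H i w. smoothed f (u i) y) {1..n}"
    by (simp only: comp_def)
  have "expectation (\<lambda>w. \<Prod>i\<in>{1..n}. \<Prod>y\<in>#?H i w. smoothed f (u i) y) =
      (\<Prod>i\<in>{1..n}. expectation (\<lambda>w. \<Prod>y\<in>#?H i w. smoothed f (u i) y))"
  proof (rule indep_vars_lebesgue_integral[OF _ ind])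
    fix i assume i: "i \<in> {1..n}"
    show "integrable P (\<lambda>w. \<Prod>y\<in>#?H i w. smoothed f (u i) y)"
    proof (rule integrable_const_bound[where B = 1])
      show "AE w in P. norm (\<Prod>y\<in>#?H i w. smoothed f (u i) y) \<le> 1"
        using prod_mset_unit_interval[of "smoothed f (u i)", OF v] by simp
      show "(\<lambda>w. \<Prod>y\<in>#?H i w. smoothed f (u i) y) \<in> borel_measurable P"
        using ind i by (auto simp: indep_vars_def)
    qed
  qed simp
  also have "\<dots> = (\<Prod>i\<in>{1..n}. exp (\<integral>y. smoothed f (u i) y - 1 \<partial>density circle (\<lambda>t. ennreal (lam t))))"
    using vm v by (intro prod.cong refl poisson_functional hidden_poisson) auto
  finally show ?thesis unfolding expectation_displaced_product[OF u] .
qed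

end

text \<open>A condition on a single test function suffices for laws of vectors: the generating
  functional factorizes over \<open>i\<close>, and each factor is the exponential of such an
  integral.\<close>

lemma observed_law_eqI:
  assumes model: "shifted_poisson_model P n m lam f K x \<epsilon> N Y"
    and model': "shifted_poisson_model P' n m lam' f' K' x' \<epsilon>' N Y'"
    and n: "n \<ge> 1"
    and eq: "\<And>u :: real \<Rightarrow> real. u \<in> borel_measurable circle \<Longrightarrow> (\<And>y. 0 \<le> u y \<and> u y \<le> 1) \<Longrightarrow>
      (\<integral>y. smoothed f u y - 1 \<partial>density circle (\<lambda>t. ennreal (lam t))) =
      (\<integral>y. smoothed f' u y - 1 \<partial>density circle (\<lambda>t. ennreal (lam' t)))"
  shows "distr P (PiM {1..n} (\<lambda>_. configurations circle)) (\<lambda>w. \<lambda>i\<in>{1..n}. N i w) =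
    distr P' (PiM {1..n} (\<lambda>_. configurations circle)) (\<lambda>w. \<lambda>i\<in>{1..n}. N i w)"
proof -
  interpret P: shifted_poisson_model P n m lam f K x \<epsilon> N Y by fact
  interpret P': shifted_poisson_model P' n m lam' f' K' x' \<epsilon>' N Y' by fact
  let ?T = "PiM {1..n} (\<lambda>_. configurations circle)"
  let ?N = "\<lambda>w. \<lambda>i\<in>{1..n}. N i w"
  show ?thesis
  proof (rule configurations_PiM_eqI)
    show "prob_space (distr P ?T ?N)" by (rule P.prob_space_distr[OF P.observed_vector_measurable])
    show "prob_space (distr P' ?T ?N)" by (rule P'.prob_space_distr[OF P'.observed_vector_measurable])
    fix C :: "(nat \<times> real set \<times> nat) set"
    assume C: "finite C" "C \<subseteq> {1..n} \<times> sets circle \<times> UNIV"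
    let ?X = "\<lambda>c w. points_in (fst (snd c)) (N (fst c) w)"
    have CD: "fst c \<in> {1..n}" "fst (snd c) \<in> sets circle" if "c \<in> C" for c using C that by auto
    have "P.prob {w\<in>space P. \<forall>c\<in>C. ?X c w = snd (snd c)} = P'.prob {w\<in>space P'. \<forall>c\<in>C. ?X c w = snd (snd c)}"
    proof (rule joint_pgf_determines_probabilities[OF P.prob_space_axioms P'.prob_space_axioms C(1)])
      fix s :: "nat \<times> real set \<times> nat \<Rightarrow> real" assume s: "\<And>c. 0 \<le> s c \<and> s c \<le> 1"
      \<comment> \<open>An atom \<open>y\<close> contributes a factor \<open>s c\<close> for every
        constraint \<open>c\<close> of process \<open>i\<close> whose set contains it. The sets may
        overlap; the product over the atoms is still the joint monomial in the counts.\<close>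
      define u where "u i y = (\<Prod>c\<in>{c\<in>C. fst c = i}. s c ^ of_bool (y \<in> fst (snd c)))" for i y
      have u01: "0 \<le> u i y \<and> u i y \<le> 1" for i y
        unfolding u_def using s by (auto intro!: prod_nonneg prod_le_1 power_le_one)
      have um: "u i \<in> borel_measurable circle" for i
        unfolding u_def
      proof (rule borel_measurable_prod)
        fix c assume "c \<in> {c\<in>C. fst c = i}"
        then have [measurable]: "fst (snd c) \<in> sets circle" using CD by auto
        have "(\<lambda>y. y \<in> fst (snd c)) \<in> measurable circle (count_space UNIV)" by measurable
        then show "(\<lambda>y. s c ^ of_bool (y \<in> fst (snd c))) \<in> borel_measurable circle"
          by (rule measurable_compose) simp
      qed
      have prod_u: "(\<Prod>y\<in>#A. u i y) = (\<Prod>c\<in>{c\<in>C. fst c = i}. s c ^ points_in (fst (snd c)) A)" for i A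
        by (induction A) (simp_all add: u_def points_in_add_mset points_in_empty power_add prod.distrib)
      have "(\<Prod>c\<in>C. s c ^ ?X c w) = (\<Prod>i\<in>{1..n}. \<Prod>y\<in>#N i w. u i y)" for w
      proof -
        have "(\<Prod>c\<in>C. s c ^ ?X c w) = (\<Prod>i\<in>{1..n}. \<Prod>c\<in>{c\<in>C. fst c = i}. s c ^ ?X c w)"
          using C(1) CD by (intro prod.group[symmetric]) auto
        also have "\<dots> = (\<Prod>i\<in>{1..n}. \<Prod>y\<in>#N i w. u i y)"
          unfolding prod_u by (intro prod.cong) auto
        finally show ?thesis .
      qed
      moreover have "P.expectation (\<lambda>w. \<Prod>i\<in>{1..n}. \<Prod>y\<in>#N i w. u i y) =
          P'.expectation (\<lambda>w. \<Prod>i\<in>{1..n}. \<Prod>y\<in>#N i w. u i y)"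
        unfolding P.generating_functional_observed[OF n um u01]
          P'.generating_functional_observed[OF n um u01] eq[OF um u01] ..
      ultimately show "(\<integral>w. (\<Prod>c\<in>C. s c ^ ?X c w) \<partial>P) = (\<integral>w. (\<Prod>c\<in>C. s c ^ ?X c w) \<partial>P')" by simp
    qed (use CD in \<open>auto intro!: measurable_compose[OF _ points_in_measurable]
           P.observed_measurable P'.observed_measurable\<close>)
    moreover have "measure (distr Q ?T ?N) {z\<in>space (distr Q ?T ?N). \<forall>c\<in>C. points_in (fst (snd c)) (z (fst c)) = snd (snd c)}
        = measure Q {w\<in>space Q. \<forall>c\<in>C. ?X c w = snd (snd c)}"
      if Q: "?N \<in> measurable Q ?T" for Q
    proof -
      have m: "{z\<in>space ?T. points_in (fst (snd c)) (z (fst c)) = snd (snd c)} \<in> sets ?T" if "c \<in> C" for c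
      proof -
        note [measurable] = CD[OF that]
        show ?thesis by measurable
      qed
      have "{z\<in>space ?T. \<forall>c\<in>C. points_in (fst (snd c)) (z (fst c)) = snd (snd c)} \<in> sets ?T"
        using C(1) m by (intro sets.sets_Collect_finite_All) auto
      moreover have "?N -` {z\<in>space ?T. \<forall>c\<in>C. points_in (fst (snd c)) (z (fst c)) = snd (snd c)} \<inter> space Q =
          {w\<in>space Q. \<forall>c\<in>C. ?X c w = snd (snd c)}"
        using measurable_space[OF Q] CD(1) by auto
      ultimately show ?thesis using Q by (simp add: measure_distr)
    qed
    ultimately show "measure (distr P ?T ?N) {z\<in>space (distr P ?T ?N). \<forall>c\<in>C. points_in (fst (snd c)) (z (fst c)) = snd (snd c)} =
        measure (distr P' ?T ?N) {z\<in>space (distr P' ?T ?N). \<forall>c\<in>C. points_in (fst (snd c)) (z (fst c)) = snd (snd c)}"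
      using P.observed_vector_measurable P'.observed_vector_measurable by simp
  qed simp_all
qed

section \<open>Fourier coefficients on the circle\<close>

interpretation circle: prob_space circle
  by (rule prob_spaceI) (simp add: emeasure_restrict_space space_restrict_space)

section \<open>Rotations of the circle\<close>

lemma emeasure_lborel_translation_vimage:
  fixes c :: real
  assumes "B \<in> sets borel"
  shows "emeasure lborel ((+) c -` B) = emeasure lborel B"
  using assms by (subst (2) lborel_distr_plus[of c, symmetric]) (simp add: emeasure_distr)

text \<open>The rotation translates by \<open>e\<close> the points that do not wrap around and by
  \<open>e - 1\<close> those that do. They land in \<open>[e, 1)\<close> and \<open>[0, e)\<close>,
  which partition the circle.\<close>

lemma distr_circle_rotation:
  assumes e: "0 \<le> e" "e < 1"
  shows "distr circle circle (\<lambda>y. frac (y + e)) = circle"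
proof (rule measure_eqI)
  have rot: "(\<lambda>y. frac (y + e)) \<in> measurable circle circle"
    by (intro frac_measurable_circle borel_measurable_add) (auto intro: measurable_restrict_space1)
  fix A assume "A \<in> sets (distr circle circle (\<lambda>y. frac (y + e)))"
  then have A: "A \<in> sets circle" by simp
  then have Ab[measurable]: "A \<in> sets borel" and A01: "A \<subseteq> {0..<1}"
    by (auto simp: sets_restrict_space_iff)
  have frac: "frac (y + e) = (if y + e < 1 then y + e else y + e - 1)" if "0 \<le> y" "y < 1" for y
  proof -
    have "\<lfloor>y + e\<rfloor> = (if y + e < 1 then 0 else 1)" using that e by (auto simp: floor_eq_iff)
    then show ?thesis by (simp add: frac_def)
  qed
  let ?V = "(\<lambda>y. frac (y + e)) -` A \<inter> space circle"
  have V: "?V = (+) e -` (A \<inter> {e..<1}) \<union> (+) (e - 1) -` (A \<inter> {0..<e})"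
    using A01 e by (auto simp: frac algebra_simps split: if_splits)
  have "emeasure circle ?V = emeasure lborel ?V"
    by (intro emeasure_restrict_space) auto
  also have "\<dots> = emeasure lborel ((+) e -` (A \<inter> {e..<1})) + emeasure lborel ((+) (e - 1) -` (A \<inter> {0..<e}))"
    unfolding V
  proof (rule plus_emeasure[symmetric])
    show "(+) e -` (A \<inter> {e..<1}) \<in> sets lborel" "(+) (e - 1) -` (A \<inter> {0..<e}) \<in> sets lborel"
      using measurable_sets[of "(+) e" borel borel "A \<inter> {e..<1}"]
        measurable_sets[of "(+) (e - 1)" borel borel "A \<inter> {0..<e}"] by auto
  qed auto
  also have "\<dots> = emeasure lborel (A \<inter> {e..<1}) + emeasure lborel (A \<inter> {0..<e})"
    by (simp add: emeasure_lborel_translation_vimage del: vimage_Int)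
  also have "\<dots> = emeasure lborel (A \<inter> {e..<1} \<union> A \<inter> {0..<e})"
    by (intro plus_emeasure) auto
  also have "A \<inter> {e..<1} \<union> A \<inter> {0..<e} = A" using A01 by auto
  also have "emeasure lborel A = emeasure circle A"
    using A01 by (intro emeasure_restrict_space[symmetric]) auto
  finally show "emeasure (distr circle circle (\<lambda>y. frac (y + e))) A = emeasure circle A"
    using rot A by (simp add: emeasure_distr)
qed simp

lemma integral_circle_rotation:
  fixes h :: "real \<Rightarrow> 'b::{banach, second_countable_topology}"
  assumes "h \<in> borel_measurable circle" "0 \<le> e" "e < 1"
  shows "(\<integral>y. h (frac (y + e)) \<partial>circle) = (\<integral>y. h y \<partial>circle)"
proof -
  have "(\<lambda>y. frac (y + e)) \<in> measurable circle circle"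
    by (intro frac_measurable_circle borel_measurable_add) (auto intro: measurable_restrict_space1)
  from integral_distr[OF this assms(1)] show ?thesis by (simp add: distr_circle_rotation assms)
qed

section \<open>Square-integrable functions\<close>

lemma L2_integrable:
  fixes g :: "real \<Rightarrow> 'b::{banach, second_countable_topology}"
  assumes "g \<in> L2"
  shows "integrable circle g"
proof (rule Bochner_Integration.integrable_bound[of _ "\<lambda>t. 1 + (norm (g t))\<^sup>2"])
  show "AE t in circle. norm (g t) \<le> norm (1 + (norm (g t))\<^sup>2)"
  proof (intro AE_I2)
    fix t
    have "0 \<le> (norm (g t) - 1)\<^sup>2" by simp
    then have "2 * norm (g t) \<le> 1 + (norm (g t))\<^sup>2" by (simp add: power2_diff)
    then show "norm (g t) \<le> norm (1 + (norm (g t))\<^sup>2)"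
      using norm_ge_zero[of "g t"] unfolding real_norm_def abs_of_nonneg[OF add_nonneg_nonneg[OF zero_le_one zero_le_power2]]
      by linarith
  qed
qed (use assms in \<open>auto simp: L2_def\<close>)

lemma bounded_mem_L2:
  fixes g :: "real \<Rightarrow> 'b::{real_normed_vector, second_countable_topology}"
  assumes "g \<in> borel_measurable circle" "\<And>t. norm (g t) \<le> C"
  shows "g \<in> L2"
proof -
  have "(norm (g t))\<^sup>2 \<le> C\<^sup>2" for t by (intro power_mono assms) simp
  then show ?thesis
    unfolding L2_def using assms(1) by (auto intro!: circle.integrable_const_bound[where B = "C\<^sup>2"])
qed

lemma add_mem_L2:
  fixes g h :: "real \<Rightarrow> 'b::{real_normed_vector, second_countable_topology}"
  assumes "g \<in> L2" "h \<in> L2"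
  shows "(\<lambda>t. g t + h t) \<in> L2"
proof -
  have [measurable]: "g \<in> borel_measurable circle" "h \<in> borel_measurable circle"
    and int: "integrable circle (\<lambda>t. 2 * (norm (g t))\<^sup>2 + 2 * (norm (h t))\<^sup>2)"
    using assms by (auto simp: L2_def)
  have "integrable circle (\<lambda>t. (norm (g t + h t))\<^sup>2)"
  proof (rule Bochner_Integration.integrable_bound[OF int])
    show "AE t in circle. norm ((norm (g t + h t))\<^sup>2) \<le> norm (2 * (norm (g t))\<^sup>2 + 2 * (norm (h t))\<^sup>2)"
    proof (intro AE_I2)
      fix t
      have "(norm (g t + h t))\<^sup>2 \<le> (norm (g t) + norm (h t))\<^sup>2"
        by (intro power_mono norm_triangle_ineq) simp
      also have "\<dots> \<le> 2 * (norm (g t))\<^sup>2 + 2 * (norm (h t))\<^sup>2"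
        using zero_le_power2[of "norm (g t) - norm (h t)"] by (simp add: power2_diff power2_sum)
      finally show "norm ((norm (g t + h t))\<^sup>2) \<le> norm (2 * (norm (g t))\<^sup>2 + 2 * (norm (h t))\<^sup>2)" by simp
    qed
  qed measurable
  then show ?thesis by (simp add: L2_def)
qed

lemma of_real_mem_L2_iff: "(\<lambda>t. complex_of_real (g t)) \<in> L2 \<longleftrightarrow> g \<in> L2"
proof -
  have "g \<in> borel_measurable circle" if "(\<lambda>t. complex_of_real (g t)) \<in> borel_measurable circle"
    using measurable_compose[OF that borel_measurable_Re] by simp
  then have "(\<lambda>t. complex_of_real (g t)) \<in> borel_measurable circle \<longleftrightarrow> g \<in> borel_measurable circle"
    by (intro iffI measurable_compose[OF _ borel_measurable_of_real]) assumption+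
  then show ?thesis by (simp only: L2_def mem_Collect_eq norm_of_real real_norm_def)
qed

section \<open>The trigonometric system and Fourier coefficients\<close>

lemma trig_measurable [measurable]: "trig j \<in> borel_measurable circle"
  unfolding trig_def[abs_def]
proof (rule measurable_restrict_space1)
  have "(\<lambda>t. exp (2 * of_real pi * \<i> * of_int j * of_real t)) \<in> borel_measurable (borel :: real measure)"
    by (intro borel_measurable_continuous_onI continuous_intros)
  then show "(\<lambda>t. exp (2 * of_real pi * \<i> * of_int j * of_real t)) \<in> borel_measurable lborel"
    by simp
qed

lemma norm_trig [simp]: "cmod (trig j t) = 1"
  by (simp add: trig_def norm_exp_eq_Re)

lemma trig_0 [simp]: "trig 0 t = 1"
  by (simp add: trig_def)

lemma trig_add: "trig j (s + t) = trig j s * trig j t"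
  by (simp add: trig_def exp_add[symmetric] algebra_simps)

lemma trig_mult_minus: "trig i t * trig j (- t) = trig (i - j) t"
  by (simp add: trig_def exp_add[symmetric] algebra_simps)

lemma trig_uminus: "trig j (- t) = trig (- j) t"
  by (simp add: trig_def)

lemma cnj_trig: "cnj (trig j t) = trig (- j) t"
  by (simp add: trig_def exp_cnj)

lemma trig_of_int: "trig j (of_int k) = 1"
proof -
  have "trig j (of_int k) = exp ((2 * of_int (j * k) * pi) * \<i>)"
    by (simp add: trig_def algebra_simps)
  then show ?thesis by (simp only: exp_integer_2pi Ints_of_int)
qed

lemma trig_frac: "trig j (frac t) = trig j t"
proof -
  have "trig j (frac t) = trig j (t + of_int (- \<lfloor>t\<rfloor>))" by (simp add: frac_def)
  then show ?thesis by (simp only: trig_add trig_of_int mult_1_right)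
qed

text \<open>For \<open>j\<close> nonzero, rotation by the half period \<open>1 / (2 * |j|)\<close>
  multiplies \<open>trig j\<close> by -1, so by rotation invariance the integral equals its own
  negative.\<close>

lemma integral_trig: "(\<integral>t. trig j t \<partial>circle) = of_bool (j = 0)"
proof (cases "j = 0")
  case False
  define e :: real where "e = 1 / (2 * \<bar>of_int j\<bar>)"
  have "1 \<le> \<bar>real_of_int j\<bar>" using False by linarith
  then have e: "0 \<le> e" "e < 1" by (auto simp: e_def field_simps)
  have "trig j e = cis (2 * pi * of_int j * e)" by (simp add: trig_def cis_conv_exp algebra_simps)
  also have "2 * pi * of_int j * e = (if j > 0 then pi else - pi)"
    using False by (auto simp: e_def)
  finally have te: "trig j e = - 1" by (auto simp: cis_pi cis.ctr complex_eq_iff split: if_splits)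
  have "(\<integral>t. trig j t \<partial>circle) = (\<integral>t. trig j (frac (t + e)) \<partial>circle)"
    by (rule integral_circle_rotation[symmetric]) (use e in auto)
  also have "\<dots> = - (\<integral>t. trig j t \<partial>circle)" by (simp add: trig_frac trig_add te)
  finally show ?thesis using False by (simp add: eq_neg_iff_add_eq_0 mult_2[symmetric])
qed (use circle.prob_space in simp)

lemma fourier_coeff_trig: "fourier_coeff (trig i) j = of_bool (i = j)"
  by (simp add: fourier_coeff_def trig_mult_minus integral_trig)

lemma integrable_mult_trig:
  assumes "integrable circle g"
  shows "integrable circle (\<lambda>t. g t * trig j (- t))"
proof (rule Bochner_Integration.integrable_bound[OF assms])
  have [measurable]: "(\<lambda>t. trig j (- t)) \<in> borel_measurable circle" "g \<in> borel_measurable circle"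
    using assms unfolding trig_uminus by auto
  show "(\<lambda>t. g t * trig j (- t)) \<in> borel_measurable circle" by measurable
qed (simp add: norm_mult)

lemma fourier_coeff_add:
  assumes "integrable circle g" "integrable circle h"
  shows "fourier_coeff (\<lambda>t. g t + h t) j = fourier_coeff g j + fourier_coeff h j"
  unfolding fourier_coeff_def distrib_right
  by (intro Bochner_Integration.integral_add integrable_mult_trig assms)

lemma fourier_coeff_diff:
  assumes "integrable circle g" "integrable circle h"
  shows "fourier_coeff (\<lambda>t. g t - h t) j = fourier_coeff g j - fourier_coeff h j"
  unfolding fourier_coeff_def left_diff_distrib
  by (intro Bochner_Integration.integral_diff integrable_mult_trig assms)

lemma fourier_coeff_cmult: "fourier_coeff (\<lambda>t. c * g t) j = c * fourier_coeff g j"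
  unfolding fourier_coeff_def mult.assoc by simp

lemma fourier_coeff_of_real_uminus:
  "fourier_coeff (\<lambda>t. of_real (g t)) (- j) = cnj (fourier_coeff (\<lambda>t. of_real (g t)) j)"
proof -
  have "cnj (\<integral>t. complex_of_real (g t) * trig j (- t) \<partial>circle) = (\<integral>t. cnj (complex_of_real (g t) * trig j (- t)) \<partial>circle)"
    by (rule Bochner_Integration.integral_cnj[symmetric])
  then show ?thesis by (simp add: fourier_coeff_def cnj_trig trig_uminus)
qed

lemma integrable_trig: "integrable circle (trig j)"
  by (rule circle.integrable_const_bound[where B = 1]) auto

text \<open>Twice the real part of \<open>z * trig k t\<close> is this number plus its conjugate,
  and conjugation turns frequency \<open>k\<close> into \<open>- k\<close>.\<close>

lemma fourier_coeff_real_trig: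
  "fourier_coeff (\<lambda>t. of_real (2 * Re (z * trig k t))) j = z * of_bool (k = j) + cnj z * of_bool (- k = j)"
proof -
  have "(\<lambda>t. complex_of_real (2 * Re (z * trig k t))) = (\<lambda>t. z * trig k t + cnj z * trig (- k) t)"
    by (simp add: fun_eq_iff cnj_trig[symmetric] complex_cnj_mult[symmetric] complex_add_cnj del: complex_cnj_mult)
  then show ?thesis
    by (simp only: fourier_coeff_add integrable_mult_right integrable_trig fourier_coeff_cmult fourier_coeff_trig)
qed

lemma fourier_coeff_const: "fourier_coeff (\<lambda>t. c) j = c * of_bool (j = 0)"
  using fourier_coeff_cmult[of c "trig 0" j] by (auto simp: fourier_coeff_trig)

lemma real_trig_bound: "\<bar>Re (z * trig k t)\<bar> \<le> cmod z"
  using abs_Re_le_cmod[of "z * trig k t"] by (simp add: norm_mult)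

lemma real_trig_measurable: "(\<lambda>t. Re (z * trig k t)) \<in> borel_measurable circle"
  by measurable

section \<open>Smoothing against trigonometric intensities\<close>

lemma prob_space_density_circle:
  assumes f: "f \<in> L2" "AE t in circle. 0 \<le> f t" "fourier_coeff (\<lambda>t. of_real (f t)) 0 = 1"
  shows "prob_space (density circle (\<lambda>t. ennreal (f t)))"
proof (rule prob_spaceI)
  have int: "integrable circle f" by (rule L2_integrable[OF f(1)])
  have "complex_of_real (\<integral>t. f t \<partial>circle) = 1"
    using f(3) by (simp add: fourier_coeff_def integral_complex_of_real)
  then have "(\<integral>t. f t \<partial>circle) = 1" by (simp only: of_real_eq_1_iff)
  then have "(\<integral>\<^sup>+t. ennreal (f t) \<partial>circle) = 1"
    using nn_integral_eq_integral[OF int f(2)] by simp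
  moreover have "f \<in> borel_measurable circle" using int by auto
  moreover have "(\<integral>\<^sup>+t. ennreal (f t) * indicator (space circle) t \<partial>circle) = (\<integral>\<^sup>+t. ennreal (f t) \<partial>circle)"
    by (intro nn_integral_cong) (auto simp: indicator_def)
  ultimately show "emeasure (density circle (\<lambda>t. ennreal (f t))) (space (density circle (\<lambda>t. ennreal (f t)))) = 1"
    using sets.top[of circle] by (subst emeasure_density) auto
qed

text \<open>An intensity that is a trigonometric polynomial of degree \<open>k\<close> sees of the error density only
  its \<open>k\<close>-th Fourier coefficient.\<close>

lemma smoothed_trig_integral:
  fixes u :: "real \<Rightarrow> real" and A B :: real
  assumes f: "f \<in> L2" "AE t in circle. 0 \<le> f t" "fourier_coeff (\<lambda>t. of_real (f t)) 0 = 1"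
    and u: "u \<in> borel_measurable circle" "\<And>y. \<bar>u y\<bar> \<le> 1"
    and lam: "\<And>t. 0 \<le> A + Re (B * trig k t)"
  shows "(\<integral>y. smoothed f u y \<partial>density circle (\<lambda>t. ennreal (A + Re (B * trig k t)))) =
    A * (\<integral>t. u t \<partial>circle) +
    Re (B * fourier_coeff (\<lambda>t. of_real (f t)) k * (\<integral>t. u t * trig k t \<partial>circle))"
proof -
  let ?F = "density circle (\<lambda>t. ennreal (f t))"
  let ?lam = "\<lambda>t. A + Re (B * trig k t)"
  interpret F: prob_space ?F by (rule prob_space_density_circle[OF f])
  interpret cF: pair_prob_space circle ?F ..
  have fm: "f \<in> borel_measurable circle" using L2_integrable[OF f(1)] by auto
  have lm: "?lam \<in> borel_measurable circle" by (intro borel_measurable_add real_trig_measurable) simp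
  have ufm: "(\<lambda>(y, e). u (frac (y + e))) \<in> borel_measurable (circle \<Otimes>\<^sub>M ?F)"
  proof -
    have "(\<lambda>(y, e). u (frac (y + e))) \<in> borel_measurable (circle \<Otimes>\<^sub>M circle)"
      unfolding case_prod_unfold
      by (intro measurable_compose[OF frac_measurable_circle u(1)] borel_measurable_add
          measurable_circle_borel[OF measurable_fst] measurable_circle_borel[OF measurable_snd])
    then show ?thesis
      by (subst measurable_cong_sets[OF sets_pair_measure_cong[OF refl sets_density] refl])
  qed
  have sm: "smoothed f u \<in> borel_measurable circle"
    unfolding smoothed_def using ufm by (rule F.borel_measurable_lebesgue_integral)
  have int: "integrable (circle \<Otimes>\<^sub>M ?F) (\<lambda>(y, e). ?lam y * u (frac (y + e)))"
  proof (rule cF.integrable_const_bound[where B = "\<bar>A\<bar> + cmod B"])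
    have "(\<lambda>z. ?lam (fst z)) \<in> borel_measurable (circle \<Otimes>\<^sub>M ?F)"
      by (rule measurable_compose[OF measurable_fst lm])
    with ufm show "(\<lambda>(y, e). ?lam y * u (frac (y + e))) \<in> borel_measurable (circle \<Otimes>\<^sub>M ?F)"
      unfolding case_prod_unfold by (rule borel_measurable_times[rotated])
    have "\<bar>?lam y * u z\<bar> \<le> (\<bar>A\<bar> + cmod B) * 1" for y z
      unfolding abs_mult using real_trig_bound[of "of_real B" k y] u(2)[of z] by (intro mult_mono) auto
    then show "AE z in circle \<Otimes>\<^sub>M ?F. norm (case z of (y, e) \<Rightarrow> ?lam y * u (frac (y + e))) \<le> \<bar>A\<bar> + cmod B"
      by (auto simp: case_prod_unfold)
  qed
  define W where "W = (\<integral>t. u t * trig k t \<partial>circle)"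
  have ti: "integrable circle (\<lambda>t. u t * trig k t)"
  proof (rule circle.integrable_const_bound[where B = 1])
    note [measurable] = u(1)
    show "(\<lambda>t. u t * trig k t) \<in> borel_measurable circle" by measurable
  qed (use u(2) in \<open>simp add: norm_mult\<close>)
  have ui: "integrable circle u"
    using u by (intro circle.integrable_const_bound[where B = 1]) auto
  have inner: "(\<integral>y. ?lam y * u (frac (y + e)) \<partial>circle) = A * (\<integral>t. u t \<partial>circle) + Re (B * trig k (- e) * W)"
    if e: "e \<in> space ?F" for e
  proof -
    have e01: "0 \<le> e" "e < 1" using e by auto
    \<comment> \<open>The intensity at \<open>y\<close> is rewritten through the displaced point, so
      that the shift by \<open>e\<close> becomes the phase \<open>trig k (- e)\<close>. Rotation
      invariance removes \<open>e\<close> everywhere else, and averaging the phase over the noise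
      yields the \<open>k\<close>-th Fourier coefficient of \<open>f\<close>.\<close>
    have z: "A + Re (B * trig k (- e) * trig k (frac (y + e))) = ?lam y" for y
      by (simp add: trig_frac trig_add[symmetric] mult.assoc)
    have "(\<integral>y. ?lam y * u (frac (y + e)) \<partial>circle) =
        (\<integral>y. (\<lambda>t. (A + Re (B * trig k (- e) * trig k t)) * u t) (frac (y + e)) \<partial>circle)"
      unfolding z ..
    also have "\<dots> = (\<integral>t. (A + Re (B * trig k (- e) * trig k t)) * u t \<partial>circle)"
      using e01 u(1) by (intro integral_circle_rotation borel_measurable_times borel_measurable_add real_trig_measurable) auto
    also have "\<dots> = (\<integral>t. A * u t + Re (B * trig k (- e) * (u t * trig k t)) \<partial>circle)"
      by (intro Bochner_Integration.integral_cong) (auto simp: algebra_simps)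
    also have "\<dots> = A * (\<integral>t. u t \<partial>circle) + (\<integral>t. Re (B * trig k (- e) * (u t * trig k t)) \<partial>circle)"
    proof (subst Bochner_Integration.integral_add)
      show "integrable circle (\<lambda>t. Re (B * trig k (- e) * (u t * trig k t)))"
        by (intro integrable_Re integrable_mult_right ti)
    qed (use ui in simp_all)
    also have "(\<integral>t. Re (B * trig k (- e) * (u t * trig k t)) \<partial>circle) = Re (B * trig k (- e) * W)"
      using ti by (subst integral_Re) (auto simp: W_def)
    finally show ?thesis .
  qed
  have "(\<integral>y. smoothed f u y \<partial>density circle (\<lambda>t. ennreal (?lam t))) = (\<integral>y. ?lam y * smoothed f u y \<partial>circle)"
    using lam by (intro integral_real_density sm lm) auto
  also have "\<dots> = (\<integral>y. (\<integral>e. ?lam y * u (frac (y + e)) \<partial>?F) \<partial>circle)"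
    by (simp add: smoothed_def)
  also have "\<dots> = (\<integral>e. (\<integral>y. ?lam y * u (frac (y + e)) \<partial>circle) \<partial>?F)"
    using cF.Fubini_integral[OF int] by simp
  also have "\<dots> = (\<integral>e. A * (\<integral>t. u t \<partial>circle) + Re (B * trig k (- e) * W) \<partial>?F)"
    by (intro Bochner_Integration.integral_cong refl inner)
  also have "\<dots> = A * (\<integral>t. u t \<partial>circle) + (\<integral>e. Re (B * trig k (- e) * W) \<partial>?F)"
  proof -
    have "integrable ?F (\<lambda>e. Re (B * trig k (- e) * W))"
    proof (rule F.integrable_const_bound[where B = "cmod (B * W)"])
      show "AE e in ?F. norm (Re (B * trig k (- e) * W)) \<le> cmod (B * W)"
        using abs_Re_le_cmod[of "B * trig k _ * W"] by (simp add: norm_mult)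
      show "(\<lambda>e. Re (B * trig k (- e) * W)) \<in> borel_measurable ?F"
        unfolding trig_uminus by measurable
    qed
    then show ?thesis using F.prob_space by simp
  qed
  also have "(\<integral>e. Re (B * trig k (- e) * W) \<partial>?F) = (\<integral>e. Re (B * W * (f e * trig k (- e))) \<partial>circle)"
  proof -
    have "(\<integral>e. Re (B * trig k (- e) * W) \<partial>?F) = (\<integral>e. f e * Re (B * trig k (- e) * W) \<partial>circle)"
      using f(2) fm unfolding trig_uminus
      by (intro integral_real_density) auto
    also have "\<dots> = (\<integral>e. Re (B * W * (f e * trig k (- e))) \<partial>circle)"
      by (intro Bochner_Integration.integral_cong) (auto simp: algebra_simps)
    finally show ?thesis .
  qed
  also have "\<dots> = Re (B * W * fourier_coeff (\<lambda>t. of_real (f t)) k)"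
    unfolding fourier_coeff_def
    by (subst integral_Re) (use integrable_mult_trig[OF integrable_of_real[OF L2_integrable[OF f(1)]]] in simp_all)
  finally show ?thesis by (simp add: W_def mult_ac)
qed

text \<open>The noise law has mass 1. Thus the \<open>- 1\<close> of the Poisson functional moves
  into the test function, which keeps absolute value at most 1 as
  \<open>smoothed_trig_integral\<close> requires.\<close>

lemma smoothed_minus_one:
  assumes f: "f \<in> L2" "AE t in circle. 0 \<le> f t" "fourier_coeff (\<lambda>t. of_real (f t)) 0 = 1"
    and u: "u \<in> borel_measurable circle" "\<And>y. 0 \<le> u y \<and> u y \<le> 1"
  shows "smoothed f u y - 1 = smoothed f (\<lambda>t. u t - 1) y"
proof -
  interpret F: prob_space "density circle (\<lambda>t. ennreal (f t))" by (rule prob_space_density_circle[OF f])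
  have "(\<lambda>e. u (frac (y + e))) \<in> borel_measurable circle"
    by (intro measurable_compose[OF frac_measurable_circle u(1)] borel_measurable_add)
       (auto intro: measurable_restrict_space1)
  then have "integrable (density circle (\<lambda>t. ennreal (f t))) (\<lambda>e. u (frac (y + e)))"
    using u(2) by (intro F.integrable_const_bound[where B = 1]) auto
  moreover have "(\<integral>e. 1 \<partial>density circle (\<lambda>t. ennreal (f t))) = (1 :: real)"
    using F.prob_space by simp
  ultimately show ?thesis
    unfolding smoothed_def by (subst Bochner_Integration.integral_diff) simp_all
qed

section \<open>Two-point lower bounds\<close>

lemma PiM_density:
  assumes I: "finite I" and M: "sigma_finite_measure M"
    and g: "g \<in> borel_measurable M" and Mg: "sigma_finite_measure (density M g)"
  shows "PiM I (\<lambda>_. density M g) = density (PiM I (\<lambda>_. M)) (\<lambda>y. \<Prod>i\<in>I. g (y i))"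
proof -
  interpret M: product_sigma_finite "\<lambda>_. M" by (intro product_sigma_finite.intro M)
  interpret Mg: product_sigma_finite "\<lambda>_. density M g" by (intro product_sigma_finite.intro Mg)
  note [measurable] = g
  have gm: "(\<lambda>y. \<Prod>i\<in>I. g (y i)) \<in> borel_measurable (PiM I (\<lambda>_. M))"
    by measurable
  show ?thesis
  proof (rule Mg.PiM_eqI[OF I, symmetric])
    show "sets (density (PiM I (\<lambda>_. M)) (\<lambda>y. \<Prod>i\<in>I. g (y i))) = sets (PiM I (\<lambda>_. density M g))"
      by (simp cong: sets_PiM_cong)
    fix A assume "\<And>i. i \<in> I \<Longrightarrow> A i \<in> sets (density M g)"
    then have A: "\<And>i. i \<in> I \<Longrightarrow> A i \<in> sets M" by simp
    have "emeasure (density (PiM I (\<lambda>_. M)) (\<lambda>y. \<Prod>i\<in>I. g (y i))) (Pi\<^sub>E I A) =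
        (\<integral>\<^sup>+y. (\<Prod>i\<in>I. g (y i)) * indicator (Pi\<^sub>E I A) y \<partial>PiM I (\<lambda>_. M))"
      using I A by (intro emeasure_density gm sets_PiM_I_finite) auto
    also have "\<dots> = (\<integral>\<^sup>+y. (\<Prod>i\<in>I. g (y i) * indicator (A i) (y i)) \<partial>PiM I (\<lambda>_. M))"
    proof (intro nn_integral_cong)
      fix y assume y: "y \<in> space (PiM I (\<lambda>_. M))"
      then have "indicator (Pi\<^sub>E I A) y = (\<Prod>i\<in>I. indicator (A i) (y i) :: ennreal)"
        using I by (auto simp: indicator_def space_PiM PiE_iff prod_eq_1_iff)
      then show "(\<Prod>i\<in>I. g (y i)) * indicator (Pi\<^sub>E I A) y = (\<Prod>i\<in>I. g (y i) * indicator (A i) (y i))"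
        by (simp add: prod.distrib)
    qed
    also have "\<dots> = (\<Prod>i\<in>I. \<integral>\<^sup>+t. g t * indicator (A i) t \<partial>M)"
      using A g by (intro M.product_nn_integral_prod I) auto
    also have "\<dots> = (\<Prod>i\<in>I. emeasure (density M g) (A i))"
      using A g by (intro prod.cong) (auto simp: emeasure_density)
    finally show "emeasure (density (PiM I (\<lambda>_. M)) (\<lambda>y. \<Prod>i\<in>I. g (y i))) (Pi\<^sub>E I A) =
        (\<Prod>i\<in>I. emeasure (density M g) (A i))" .
  qed
qed

text \<open>Weighted AM-GM: for a the smaller and b the larger number,
  \<open>sqrt (a * b) \<le> 2 * a + b / 8\<close>, and \<open>a / 8\<close> is added for symmetry.
  The bound is linear in the minimum and the sum, so it can be integrated term by term; its weights
  turn affinity 1/2 into overlap 1/8.\<close>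

lemma sqrt_mult_le_min:
  fixes p q :: real
  assumes "0 \<le> p" "0 \<le> q"
  shows "sqrt (p * q) \<le> 2 * min p q + (p + q) / 8"
proof (rule real_le_lsqrt)
  define a b where "a = min p q" and "b = max p q"
  have ab: "0 \<le> a" "0 \<le> b" "p * q = a * b" "p + q = a + b" using assms by (auto simp: a_def b_def min_def max_def)
  have "(2 * a + (a + b) / 8)\<^sup>2 - a * b = (2 * a - b / 8)\<^sup>2 + (a / 8)\<^sup>2 + 2 * (a / 8) * (2 * a + b / 8)"
    by (simp add: power2_eq_square field_simps)
  moreover have "0 \<le> (2 * a - b / 8)\<^sup>2 + (a / 8)\<^sup>2 + 2 * (a / 8) * (2 * a + b / 8)" using ab by simp
  ultimately show "p * q \<le> (2 * min p q + (p + q) / 8)\<^sup>2" unfolding ab a_def[symmetric] by linarith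
qed (use assms in auto)

text \<open>Le Cam's bound: the Hellinger affinity of the one-dimensional densities tensorizes, and it
  bounds the overlap of the product measures from below.\<close>

lemma product_overlap_ge:
  fixes p q :: "'b \<Rightarrow> real"
  assumes M: "sigma_finite_measure M" and I: "finite I" "I \<noteq> {}"
    and p: "p \<in> borel_measurable M" "\<And>t. 0 \<le> p t" "(\<integral>\<^sup>+t. ennreal (p t) \<partial>M) = 1"
    and q: "q \<in> borel_measurable M" "\<And>t. 0 \<le> q t" "(\<integral>\<^sup>+t. ennreal (q t) \<partial>M) = 1"
    and affinity: "ennreal (1 - 1 / (2 * card I)) \<le> (\<integral>\<^sup>+t. ennreal (sqrt (p t * q t)) \<partial>M)"
  shows "ennreal (1 / 8) \<le> (\<integral>\<^sup>+y. min (\<Prod>i\<in>I. ennreal (p (y i))) (\<Prod>i\<in>I. ennreal (q (y i))) \<partial>PiM I (\<lambda>_. M))"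
    (is "_ \<le> ?J")
proof -
  interpret M: product_sigma_finite "\<lambda>_. M" by (intro product_sigma_finite.intro M)
  note [measurable] = p(1) q(1)
  let ?T = "PiM I (\<lambda>_. M)"
  let ?P = "\<lambda>y. \<Prod>i\<in>I. ennreal (p (y i))" and ?Q = "\<lambda>y. \<Prod>i\<in>I. ennreal (q (y i))"
  have [measurable]: "?P \<in> borel_measurable ?T" "?Q \<in> borel_measurable ?T"
    by measurable
  define m where "m = card I"
  have m: "m \<ge> 1" using I by (simp add: m_def card_gt_0_iff Suc_le_eq)
  \<comment> \<open>Bernoulli's inequality: the \<open>m\<close>-th power of
    \<open>1 - 1 / (2 * m)\<close> is still at least 1/2.\<close>
  have "1 / 2 = 1 + real m * (- 1 / (2 * real m))" using m by simp
  also have "\<dots> \<le> (1 + - 1 / (2 * real m)) ^ m" using m by (intro Bernoulli_inequality) (simp add: field_simps)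
  finally have bern: "ennreal (1 / 2) \<le> ennreal ((1 - 1 / (2 * m)) ^ m)" by (intro ennreal_leI) simp
  have "ennreal ((1 - 1 / (2 * m)) ^ m) = ennreal (1 - 1 / (2 * m)) ^ m"
    using m by (intro ennreal_power[symmetric]) (simp add: field_simps)
  also have "\<dots> \<le> (\<integral>\<^sup>+t. ennreal (sqrt (p t * q t)) \<partial>M) ^ m"
    using affinity by (intro power_mono) (simp_all add: m_def)
  also have "\<dots> = (\<Prod>i\<in>I. \<integral>\<^sup>+t. ennreal (sqrt (p t * q t)) \<partial>M)" by (simp add: m_def)
  also have "\<dots> = (\<integral>\<^sup>+y. (\<Prod>i\<in>I. ennreal (sqrt (p (y i) * q (y i)))) \<partial>?T)"
    by (intro M.product_nn_integral_prod[symmetric] I) measurable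
  also have "\<dots> \<le> (\<integral>\<^sup>+y. 2 * min (?P y) (?Q y) + (?P y + ?Q y) * ennreal (1 / 8) \<partial>?T)"
  proof (intro nn_integral_mono)
    fix y
    define a b where "a = (\<Prod>i\<in>I. p (y i))" and "b = (\<Prod>i\<in>I. q (y i))"
    have ab: "0 \<le> a" "0 \<le> b" using p(2) q(2) by (auto simp: a_def b_def intro: prod_nonneg)
    have "(\<Prod>i\<in>I. sqrt (p (y i) * q (y i))) = sqrt (a * b)"
      unfolding a_def b_def using I(1) by induction (simp_all add: real_sqrt_mult)
    then have "(\<Prod>i\<in>I. ennreal (sqrt (p (y i) * q (y i)))) = ennreal (sqrt (a * b))"
      using p(2) q(2) by (subst prod_ennreal) auto
    also have "\<dots> \<le> ennreal (2 * min a b + (a + b) * (1 / 8))"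
      using sqrt_mult_le_min[OF ab] by (intro ennreal_leI) simp
    also have "\<dots> = 2 * min (ennreal a) (ennreal b) + (ennreal a + ennreal b) * ennreal (1 / 8)"
    proof -
      have "ennreal (min a b) = min (ennreal a) (ennreal b)" using ab by (auto simp: min_def ennreal_le_iff)
      moreover have "0 \<le> min a b" using ab by simp
      ultimately show ?thesis
        using ab by (simp only: ennreal_plus ennreal_mult mult_nonneg_nonneg add_nonneg_nonneg ennreal_numeral)
    qed
    also have "\<dots> = 2 * min (?P y) (?Q y) + (?P y + ?Q y) * ennreal (1 / 8)"
      using p(2) q(2) by (simp add: a_def b_def prod_ennreal)
    finally show "(\<Prod>i\<in>I. ennreal (sqrt (p (y i) * q (y i)))) \<le> 2 * min (?P y) (?Q y) + (?P y + ?Q y) * ennreal (1 / 8)" .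
  qed
  also have "\<dots> = 2 * ?J + ((\<integral>\<^sup>+y. ?P y \<partial>?T) + (\<integral>\<^sup>+y. ?Q y \<partial>?T)) * ennreal (1 / 8)"
    by (simp add: nn_integral_add nn_integral_cmult nn_integral_multc)
  also have "(\<integral>\<^sup>+y. ?P y \<partial>?T) = 1"
    using p I by (subst M.product_nn_integral_prod) auto
  also have "(\<integral>\<^sup>+y. ?Q y \<partial>?T) = 1"
    using q I by (subst M.product_nn_integral_prod) auto
  \<comment> \<open>The two product densities have integral 1, so the pointwise bound integrates to
    twice the overlap plus 1/4. Comparison with 1/2 leaves 1/8 for the overlap.\<close>
  finally have fin: "ennreal (1 / 2) \<le> 2 * ?J + (1 + 1) * ennreal (1 / 8)" using bern order_trans by blast
  show ?thesis
  proof (cases ?J)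
    case (real j)
    have "(1 + 1) * ennreal (1 / 8) = ennreal 2 * ennreal (1 / 8)" by simp
    also have "\<dots> = ennreal (1 / 4)" by (subst ennreal_mult[symmetric]) simp_all
    finally have "2 * ?J + (1 + 1) * ennreal (1 / 8) = ennreal 2 * ennreal j + ennreal (1 / 4)"
      using real by simp
    also have "\<dots> = ennreal (2 * j + 1 / 4)"
      using real(1) by (subst ennreal_mult[symmetric], simp, simp, subst ennreal_plus) simp_all
    finally have "ennreal (1 / 2) \<le> ennreal (2 * j + 1 / 4)" using fin by simp
    then have "1 / 2 \<le> 2 * j + 1 / 4" using real(1) by (subst (asm) ennreal_le_iff) simp_all
    then have "1 / 8 \<le> j" by simp
    then show ?thesis using real by (simp add: ennreal_leI)
  qed simp
qed

text \<open>The factor \<open>Q\<close>, standing for the law of the point processes, is common to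
  both hypotheses, so the difference sits in the sample densities. Both product densities dominate
  their minimum, and against the minimum the losses \<open>G\<close> and \<open>H\<close> add up to
  at least \<open>c\<close>; what remains is \<open>c\<close> times the overlap.\<close>

lemma two_point_bound:
  fixes p q :: "'b \<Rightarrow> real"
  assumes M: "sigma_finite_measure M" and I: "finite I" "I \<noteq> {}"
    and p: "p \<in> borel_measurable M" "\<And>t. 0 \<le> p t" "(\<integral>\<^sup>+t. ennreal (p t) \<partial>M) = 1"
    and q: "q \<in> borel_measurable M" "\<And>t. 0 \<le> q t" "(\<integral>\<^sup>+t. ennreal (q t) \<partial>M) = 1"
    and affinity: "ennreal (1 - 1 / (2 * card I)) \<le> (\<integral>\<^sup>+t. ennreal (sqrt (p t * q t)) \<partial>M)"
    and Q: "prob_space Q"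
    and G: "G \<in> borel_measurable (Q \<Otimes>\<^sub>M PiM I (\<lambda>_. M))" and H: "H \<in> borel_measurable (Q \<Otimes>\<^sub>M PiM I (\<lambda>_. M))"
    and GH: "\<And>z. z \<in> space (Q \<Otimes>\<^sub>M PiM I (\<lambda>_. M)) \<Longrightarrow> ennreal c \<le> G z + H z"
  shows "ennreal c * ennreal (1 / 8) \<le>
    (\<integral>\<^sup>+z. G z \<partial>(Q \<Otimes>\<^sub>M PiM I (\<lambda>_. density M (\<lambda>t. ennreal (p t))))) +
    (\<integral>\<^sup>+z. H z \<partial>(Q \<Otimes>\<^sub>M PiM I (\<lambda>_. density M (\<lambda>t. ennreal (q t)))))"
proof -
  interpret M: product_sigma_finite "\<lambda>_. M" by (intro product_sigma_finite.intro M)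
  interpret T: sigma_finite_measure "PiM I (\<lambda>_. M)" by (intro M.sigma_finite I)
  interpret Q: prob_space Q by fact
  let ?T = "PiM I (\<lambda>_. M)"
  let ?P = "\<lambda>y. \<Prod>i\<in>I. ennreal (p (y i))" and ?Q = "\<lambda>y. \<Prod>i\<in>I. ennreal (q (y i))"
  note [measurable] = p(1) q(1)
  have m[measurable]: "?P \<in> borel_measurable ?T" "?Q \<in> borel_measurable ?T"
    by measurable
  have prob: "prob_space (density M (\<lambda>t. ennreal (g t)))"
    if [measurable]: "g \<in> borel_measurable M" and "(\<integral>\<^sup>+t. ennreal (g t) \<partial>M) = 1" for g
  proof (rule prob_spaceI)
    have "(\<integral>\<^sup>+t. ennreal (g t) * indicator (space M) t \<partial>M) = (\<integral>\<^sup>+t. ennreal (g t) \<partial>M)"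
      by (intro nn_integral_cong) simp
    then show "emeasure (density M (\<lambda>t. ennreal (g t))) (space (density M (\<lambda>t. ennreal (g t)))) = 1"
      using that by (simp add: emeasure_density)
  qed
  have unfold: "(\<integral>\<^sup>+z. F z \<partial>(Q \<Otimes>\<^sub>M PiM I (\<lambda>_. density M (\<lambda>t. ennreal (g t))))) =
      (\<integral>\<^sup>+x. \<integral>\<^sup>+y. (\<Prod>i\<in>I. ennreal (g (y i))) * F (x, y) \<partial>?T \<partial>Q)"
    if F: "F \<in> borel_measurable (Q \<Otimes>\<^sub>M ?T)"
      and g[measurable]: "g \<in> borel_measurable M" and g1: "(\<integral>\<^sup>+t. ennreal (g t) \<partial>M) = 1" for F g
  proof -
    let ?D = "density M (\<lambda>t. ennreal (g t))"
    interpret D: prob_space ?D by (rule prob[OF g g1])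
    interpret DD: prob_space "PiM I (\<lambda>_. ?D)" by (intro prob_space_PiM D.prob_space_axioms)
    have D: "PiM I (\<lambda>_. ?D) = density ?T (\<lambda>y. \<Prod>i\<in>I. ennreal (g (y i)))"
      by (intro PiM_density I M D.sigma_finite_measure_axioms) simp
    have s: "sets (Q \<Otimes>\<^sub>M PiM I (\<lambda>_. ?D)) = sets (Q \<Otimes>\<^sub>M ?T)"
      by (intro sets_pair_measure_cong) (simp_all cong: sets_PiM_cong)
    have gm: "(\<lambda>y. \<Prod>i\<in>I. ennreal (g (y i))) \<in> borel_measurable ?T" by measurable
    have "(\<integral>\<^sup>+z. F z \<partial>(Q \<Otimes>\<^sub>M PiM I (\<lambda>_. ?D))) = (\<integral>\<^sup>+x. \<integral>\<^sup>+y. F (x, y) \<partial>PiM I (\<lambda>_. ?D) \<partial>Q)"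
      using F by (intro DD.nn_integral_fst[symmetric]) (simp cong: measurable_cong_sets[OF s refl])
    also have "\<dots> = (\<integral>\<^sup>+x. \<integral>\<^sup>+y. (\<Prod>i\<in>I. ennreal (g (y i))) * F (x, y) \<partial>?T \<partial>Q)"
      unfolding D
      by (intro nn_integral_cong nn_integral_density gm measurable_compose[OF measurable_Pair1' F])
    finally show ?thesis .
  qed
  have Gx: "(\<lambda>y. G (x, y)) \<in> borel_measurable ?T" "(\<lambda>y. H (x, y)) \<in> borel_measurable ?T" if "x \<in> space Q" for x
    using that by (auto intro: measurable_compose[OF measurable_Pair1' G] measurable_compose[OF measurable_Pair1' H])
  have "ennreal c * ennreal (1 / 8) \<le> ennreal c * (\<integral>\<^sup>+y. min (?P y) (?Q y) \<partial>?T)"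
    by (intro mult_left_mono product_overlap_ge assms) simp
  also have "\<dots> = (\<integral>\<^sup>+x. ennreal c * (\<integral>\<^sup>+y. min (?P y) (?Q y) \<partial>?T) \<partial>Q)"
    using Q.emeasure_space_1 by simp
  also have "\<dots> = (\<integral>\<^sup>+x. \<integral>\<^sup>+y. ennreal c * min (?P y) (?Q y) \<partial>?T \<partial>Q)"
    by (subst nn_integral_cmult) simp_all
  also have "\<dots> \<le> (\<integral>\<^sup>+x. \<integral>\<^sup>+y. ?P y * G (x, y) + ?Q y * H (x, y) \<partial>?T \<partial>Q)"
  proof (intro nn_integral_mono)
    fix x y assume "x \<in> space Q" "y \<in> space ?T"
    then have "ennreal c * min (?P y) (?Q y) \<le> (G (x, y) + H (x, y)) * min (?P y) (?Q y)"
      by (intro mult_right_mono GH) (auto simp: space_pair_measure)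
    also have "\<dots> \<le> ?P y * G (x, y) + ?Q y * H (x, y)"
      unfolding distrib_right by (intro add_mono; subst mult.commute; intro mult_right_mono) auto
    finally show "ennreal c * min (?P y) (?Q y) \<le> ?P y * G (x, y) + ?Q y * H (x, y)" .
  qed
  also have "\<dots> = (\<integral>\<^sup>+x. (\<integral>\<^sup>+y. ?P y * G (x, y) \<partial>?T) + (\<integral>\<^sup>+y. ?Q y * H (x, y) \<partial>?T) \<partial>Q)"
  proof (intro nn_integral_cong)
    fix x assume "x \<in> space Q"
    note [measurable] = Gx[OF this]
    show "(\<integral>\<^sup>+y. ?P y * G (x, y) + ?Q y * H (x, y) \<partial>?T) = (\<integral>\<^sup>+y. ?P y * G (x, y) \<partial>?T) + (\<integral>\<^sup>+y. ?Q y * H (x, y) \<partial>?T)"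
      by (rule nn_integral_add) measurable
  qed
  also have "\<dots> = (\<integral>\<^sup>+x. \<integral>\<^sup>+y. ?P y * G (x, y) \<partial>?T \<partial>Q) + (\<integral>\<^sup>+x. \<integral>\<^sup>+y. ?Q y * H (x, y) \<partial>?T \<partial>Q)"
  proof (rule nn_integral_add)
    have "(\<lambda>(x, y). ?P y * G (x, y)) \<in> borel_measurable (Q \<Otimes>\<^sub>M ?T)"
      using G by (auto simp: case_prod_unfold intro!: borel_measurable_times measurable_compose[OF measurable_snd m(1)])
    then show "(\<lambda>x. \<integral>\<^sup>+y. ?P y * G (x, y) \<partial>?T) \<in> borel_measurable Q"
      by (rule T.borel_measurable_nn_integral)
    have "(\<lambda>(x, y). ?Q y * H (x, y)) \<in> borel_measurable (Q \<Otimes>\<^sub>M ?T)"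
      using H by (auto simp: case_prod_unfold intro!: borel_measurable_times measurable_compose[OF measurable_snd m(2)])
    then show "(\<lambda>x. \<integral>\<^sup>+y. ?Q y * H (x, y) \<partial>?T) \<in> borel_measurable Q"
      by (rule T.borel_measurable_nn_integral)
  qed
  finally show ?thesis by (simp add: unfold[OF G p(1,3)] unfold[OF H q(1,3)])
qed

section \<open>The two hypotheses\<close>

lemma weighted_norm_sq_ge_two_terms:
  assumes "j \<noteq> k" "0 \<le> w j" "0 \<le> w k"
  shows "ennreal (w j * (cmod (fourier_coeff g j))\<^sup>2 + w k * (cmod (fourier_coeff g k))\<^sup>2) \<le> weighted_norm_sq w g"
proof -
  have "(\<Sum>i\<in>{j, k}. ennreal (w i * (cmod (fourier_coeff g i))\<^sup>2)) \<le> weighted_norm_sq w g"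
    unfolding weighted_norm_sq_def infsum_finite[symmetric, OF finite.insertI[OF finite.insertI[OF finite.emptyI]]]
    by (rule infsum_mono_neutral) (simp_all add: nonneg_summable_on_complete)
  then show ?thesis using assms by (simp add: ennreal_plus)
qed

text \<open>The squared coefficients are \<open>A^2\<close> at 0 and \<open>(B / 2)^2\<close> at
  each of \<open>k\<close> and \<open>- k\<close>, whence the budget in the last hypothesis.\<close>

lemma trig_polynomial_mem_Lambda_class:
  fixes A B :: real
  assumes k: "k \<noteq> 0" and pos: "\<And>t. 0 \<le> A + Re (B * trig k t)"
    and \<gamma>: "\<And>j. 0 < \<gamma> j" "\<gamma> 0 = 1" "\<gamma> (- k) = \<gamma> k"
    and r: "A\<^sup>2 + \<gamma> k * B\<^sup>2 / 2 \<le> r"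
  shows "(\<lambda>t. A + Re (B * trig k t)) \<in> Lambda_class \<gamma> r"
    and "fourier_coeff (\<lambda>t. of_real (A + Re (B * trig k t))) j =
      of_real A * of_bool (j = 0) + of_real (B / 2) * (of_bool (k = j) + of_bool (- k = j))"
proof -
  let ?l = "\<lambda>t. A + Re (B * trig k t)"
  have lm: "?l \<in> borel_measurable circle" by (intro borel_measurable_add real_trig_measurable) simp
  have L2: "?l \<in> L2"
  proof (rule bounded_mem_L2[OF lm])
    show "norm (?l t) \<le> \<bar>A\<bar> + \<bar>B\<bar>" for t using real_trig_bound[of "of_real B" k t] by auto
  qed
  have coeff: "fourier_coeff (\<lambda>t. of_real (?l t)) j =
      of_real A * of_bool (j = 0) + of_real (B / 2) * (of_bool (k = j) + of_bool (- k = j))" for j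
  proof -
    have eq: "(\<lambda>t. complex_of_real (?l t)) = (\<lambda>t. of_real A + of_real (2 * Re (of_real (B / 2) * trig k t)))"
      by (simp add: fun_eq_iff)
    have "integrable circle (\<lambda>t. complex_of_real (2 * Re (of_real (B / 2) * trig k t)))"
      by (intro integrable_of_real integrable_mult_right integrable_Re integrable_trig)
    then have "fourier_coeff (\<lambda>t. of_real (?l t)) j = of_real A * of_bool (j = 0) +
        (of_real (B / 2) * of_bool (k = j) + cnj (of_real (B / 2)) * of_bool (- k = j))"
      unfolding eq by (subst fourier_coeff_add)
        (simp_all only: circle.integrable_const fourier_coeff_const fourier_coeff_real_trig)
    then show ?thesis by (simp only: complex_cnj_complex_of_real distrib_left)
  qed
  then show "fourier_coeff (\<lambda>t. of_real (?l t)) j =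
      of_real A * of_bool (j = 0) + of_real (B / 2) * (of_bool (k = j) + of_bool (- k = j))" .
  let ?c = "\<lambda>j. ennreal (\<gamma> j * (cmod (fourier_coeff (\<lambda>t. of_real (?l t)) j))\<^sup>2)"
  have "weighted_norm_sq \<gamma> (\<lambda>t. of_real (?l t)) = (\<Sum>\<^sub>\<infinity>j\<in>{0, k, - k}. ?c j)"
    unfolding weighted_norm_sq_def coeff by (rule infsum_cong_neutral) auto
  also have "\<dots> = (\<Sum>j\<in>{0, k, - k}. ?c j)" by simp
  also have "\<dots> = ennreal (A\<^sup>2) + (ennreal (\<gamma> k * (B / 2)\<^sup>2) + ennreal (\<gamma> k * (B / 2)\<^sup>2))"
    using k \<gamma> unfolding coeff by (simp add: norm_divide power_divide)
  also have "\<dots> = ennreal (A\<^sup>2 + (\<gamma> k * (B / 2)\<^sup>2 + \<gamma> k * (B / 2)\<^sup>2))"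
    using \<gamma>(1)[of k] by ((subst ennreal_plus, simp, simp)+)
  also have "\<dots> \<le> ennreal r"
    using r by (intro ennreal_leI) (simp add: power_divide field_simps)
  finally show "?l \<in> Lambda_class \<gamma> r"
    using L2 pos by (simp add: Lambda_class_def)
qed

text \<open>Raising \<open>f\<close> to 1/2 where it falls below changes it on a null set only and
  so preserves its coefficients and its class. A bound valid everywhere allows pointwise estimates
  from here on.\<close>

lemma F_class_bounded_below_version:
  assumes f: "f \<in> F_class \<alpha> s" "AE t in circle. 1 / 2 \<le> f t"
  shows "\<exists>g\<in>F_class \<alpha> s. \<forall>t. 1 / 2 \<le> g t"
proof (intro bexI allI)
  let ?g = "\<lambda>t. max (f t) (1 / 2)"
  have AE: "AE t in circle. f t = ?g t" using f(2) by eventually_elim simp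
  have fL: "f \<in> L2" using f(1) by (simp add: F_class_def)
  then have fm[measurable]: "f \<in> borel_measurable circle" by (simp add: L2_def)
  have "integrable circle (\<lambda>t. (norm (?g t))\<^sup>2) = integrable circle (\<lambda>t. (norm (f t))\<^sup>2)"
    using AE by (intro integrable_cong_AE) (measurable, auto)
  then have gL: "?g \<in> L2" using fL by (simp add: L2_def)
  have "fourier_coeff (\<lambda>t. of_real (?g t)) j = fourier_coeff (\<lambda>t. of_real (f t)) j" for j
    unfolding fourier_coeff_def trig_uminus
  proof (rule integral_cong_AE)
    show "AE t in circle. complex_of_real (?g t) * trig (- j) t = complex_of_real (f t) * trig (- j) t"
      using AE by eventually_elim simp
  qed measurable
  then show "?g \<in> F_class \<alpha> s" using f(1) gL by (simp add: F_class_def)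
qed simp

text \<open>The perturbation multiplies the coefficients at \<open>k\<close> and \<open>- k\<close>
  by \<open>1 + \<tau>\<close> and fixes all others. Its absolute value is at most
  \<open>2 * |\<tau>| * |F|\<close> with \<open>|F| \<le> D\<close>, hence at most 1/2, so
  \<open>g\<close> stays non-negative. As \<open>1 + \<tau>\<close> lies between
  \<open>1 / D\<close> and \<open>D\<close>, the class constant grows from \<open>D^2\<close> to
  \<open>D^4\<close>.\<close>

lemma perturbed_density_mem_F_class:
  fixes f g :: "real \<Rightarrow> real" and D \<tau> \<zeta> :: real and k :: int and F :: complex
  defines "F \<equiv> fourier_coeff (\<lambda>t. of_real (f t)) k"
    and "g \<equiv> \<lambda>t. f t + 2 * Re (of_real \<tau> * fourier_coeff (\<lambda>t. of_real (f t)) k * trig k t)"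
  assumes D: "1 \<le> D" and f: "f \<in> F_class \<alpha> (D\<^sup>2)" "\<And>t. 1 / 2 \<le> f t" and k: "k \<noteq> 0"
    and \<alpha>: "\<And>j. 0 < \<alpha> j" "\<alpha> k \<le> 1"
    and \<tau>: "\<bar>\<tau>\<bar> \<le> \<zeta>" "\<zeta> \<le> 1 / (4 * D\<^sup>2)" "\<zeta> \<le> 1 - 1 / D"
  shows "g \<in> F_class \<alpha> (D ^ 4)" "0 \<le> g t" "fourier_coeff (\<lambda>t. of_real (g t)) k = (1 + of_real \<tau>) * F"
    "\<tau>\<^sup>2 * (cmod F)\<^sup>2 \<le> \<tau>\<^sup>2 * (D\<^sup>2 * \<alpha> k)"
    "cmod (of_real \<tau> * F) \<le> 1 / 4"
proof -
  have fL: "f \<in> L2" and f0: "fourier_coeff (\<lambda>t. of_real (f t)) 0 = 1"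
    and fb: "\<And>j. 1 / D\<^sup>2 \<le> (cmod (fourier_coeff (\<lambda>t. of_real (f t)) j))\<^sup>2 / \<alpha> j"
      "\<And>j. (cmod (fourier_coeff (\<lambda>t. of_real (f t)) j))\<^sup>2 / \<alpha> j \<le> D\<^sup>2"
    using f(1) by (auto simp: F_class_def)
  have F2: "(cmod F)\<^sup>2 \<le> D\<^sup>2 * \<alpha> k" using fb(2)[of k] \<alpha>(1)[of k] by (simp add: F_def divide_le_eq)
  then show "\<tau>\<^sup>2 * (cmod F)\<^sup>2 \<le> \<tau>\<^sup>2 * (D\<^sup>2 * \<alpha> k)" by (intro mult_left_mono) simp_all
  have "D\<^sup>2 * \<alpha> k \<le> D\<^sup>2" using \<alpha>(2) by (intro mult_left_le) simp_all
  with F2 have "(cmod F)\<^sup>2 \<le> D\<^sup>2" by linarith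
  then have FD: "cmod F \<le> D" by (rule power2_le_imp_le) (use D in simp)
  have "cmod (of_real \<tau> * F) \<le> (1 / (4 * D\<^sup>2)) * D"
    unfolding norm_mult using FD \<tau> D by (intro mult_mono) auto
  also have "\<dots> = 1 / (4 * D)" using D by (simp add: power2_eq_square)
  also have "\<dots> \<le> 1 / 4" using D by (simp add: field_simps)
  finally show tF: "cmod (of_real \<tau> * F) \<le> 1 / 4" .
  have small: "\<bar>Re (of_real \<tau> * F * trig k t)\<bar> \<le> 1 / 4" for t
    using real_trig_bound[of "of_real \<tau> * F" k t] tF by linarith
  have pos: "0 \<le> g t" for t
    using small[of t] f(2)[of t] unfolding g_def F_def by linarith
  then show "0 \<le> g t" .
  have hL: "(\<lambda>t. 2 * Re (of_real \<tau> * F * trig k t)) \<in> L2"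
  proof (rule bounded_mem_L2)
    show "(\<lambda>t. 2 * Re (of_real \<tau> * F * trig k t)) \<in> borel_measurable circle"
      by (intro borel_measurable_times real_trig_measurable) simp
    show "norm (2 * Re (of_real \<tau> * F * trig k t)) \<le> 1 / 2" for t
      using small[of t] unfolding real_norm_def by linarith
  qed
  have gL: "g \<in> L2" using add_mem_L2[OF fL hL] by (simp add: g_def F_def)
  have coeff: "fourier_coeff (\<lambda>t. of_real (g t)) j =
      (1 + of_real \<tau> * (of_bool (k = j) + of_bool (- k = j))) * fourier_coeff (\<lambda>t. of_real (f t)) j" for j
  proof -
    have "(\<lambda>t. complex_of_real (g t)) = (\<lambda>t. of_real (f t) + of_real (2 * Re (of_real \<tau> * F * trig k t)))"
      by (simp add: g_def F_def fun_eq_iff)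
    then have "fourier_coeff (\<lambda>t. of_real (g t)) j = fourier_coeff (\<lambda>t. of_real (f t)) j +
        fourier_coeff (\<lambda>t. of_real (2 * Re (of_real \<tau> * F * trig k t))) j"
      by (simp only: fourier_coeff_add integrable_of_real L2_integrable fL hL)
    also have "\<dots> = fourier_coeff (\<lambda>t. of_real (f t)) j +
        (of_real \<tau> * F * of_bool (k = j) + of_real \<tau> * cnj F * of_bool (- k = j))"
      by (simp only: fourier_coeff_real_trig complex_cnj_mult complex_cnj_complex_of_real)
    finally show ?thesis
      using fourier_coeff_of_real_uminus[of f k] k by (auto simp: F_def algebra_simps)
  qed
  show "fourier_coeff (\<lambda>t. of_real (g t)) k = (1 + of_real \<tau>) * F"
    using k by (simp add: coeff F_def)
  have "1 / D \<le> 1 - \<zeta>" using \<tau>(3) by simp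
  \<comment> \<open>\<open>2 - 1 / D \<le> D\<close> is \<open>(D - 1)^2 \<ge> 0\<close> divided by
    \<open>D\<close>; thus the bound made for the lower factor \<open>1 / D\<close> also controls
    the upper one.\<close>
  have "1 + \<zeta> \<le> 2 - 1 / D" using \<tau>(3) by simp
  also have "\<dots> \<le> D"
    using D zero_le_power2[of "D - 1"] by (simp add: field_simps power2_eq_square)
  finally have up: "1 + \<zeta> \<le> D" .
  have bnd: "1 / D ^ 4 \<le> (1 + \<sigma>)\<^sup>2 * x \<and> (1 + \<sigma>)\<^sup>2 * x \<le> D ^ 4"
    if x: "1 / D\<^sup>2 \<le> x" "x \<le> D\<^sup>2" and \<sigma>: "\<bar>\<sigma>\<bar> \<le> \<zeta>" for x \<sigma> :: real
  proof -
    have lo: "1 / D \<le> 1 + \<sigma>" and hi: "1 + \<sigma> \<le> D" using \<sigma> up \<open>1 / D \<le> 1 - \<zeta>\<close> by auto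
    have D0: "0 \<le> 1 / D" using D by simp
    have "(1 / D)\<^sup>2 * (1 / D\<^sup>2) \<le> (1 + \<sigma>)\<^sup>2 * x"
      using lo x D0 by (intro mult_mono power_mono) (auto simp: zero_le_power2)
    moreover have "(1 + \<sigma>)\<^sup>2 * x \<le> D\<^sup>2 * D\<^sup>2"
    proof (intro mult_mono power_mono hi x(2))
      show "0 \<le> 1 + \<sigma>" using lo D0 by linarith
      have "0 \<le> 1 / D\<^sup>2" by simp
      then show "0 \<le> x" using x(1) by linarith
    qed simp
    ultimately show ?thesis by (simp add: power_divide power_add[symmetric])
  qed
  have "1 / D ^ 4 \<le> (cmod (fourier_coeff (\<lambda>t. of_real (g t)) j))\<^sup>2 / \<alpha> j \<and>
      (cmod (fourier_coeff (\<lambda>t. of_real (g t)) j))\<^sup>2 / \<alpha> j \<le> D ^ 4" for j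
  proof -
    define \<sigma> where "\<sigma> = \<tau> * of_bool (k = j \<or> - k = j)"
    have "fourier_coeff (\<lambda>t. of_real (g t)) j = of_real (1 + \<sigma>) * fourier_coeff (\<lambda>t. of_real (f t)) j"
      unfolding coeff using k by (auto simp: \<sigma>_def)
    then have "(cmod (fourier_coeff (\<lambda>t. of_real (g t)) j))\<^sup>2 / \<alpha> j =
        (1 + \<sigma>)\<^sup>2 * ((cmod (fourier_coeff (\<lambda>t. of_real (f t)) j))\<^sup>2 / \<alpha> j)"
      by (simp only: norm_mult norm_of_real power_mult_distrib power2_abs times_divide_eq_right)
    moreover have "\<bar>\<sigma>\<bar> \<le> \<zeta>" using \<tau>(1) by (auto simp: \<sigma>_def)
    ultimately show ?thesis using bnd[OF fb(1)[of j] fb(2)[of j], of \<sigma>] by (simp only:)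
  qed
  moreover have "fourier_coeff (\<lambda>t. of_real (g t)) 0 = 1" using k f0 by (simp add: coeff)
  ultimately show "g \<in> F_class \<alpha> (D ^ 4)"
    using gL pos by (simp add: F_class_def)
qed

text \<open>The product under the root is \<open>f^2 - h^2\<close>. Since
  \<open>f \<ge> 1/2 \<ge> e\<close>, both \<open>e^2\<close> and \<open>h^2\<close> are at most
  \<open>f * e\<close>, so \<open>(f - e)^2 = f^2 - 2 * f * e + e^2\<close> does not exceed it, and
  \<open>f - e\<close> integrates to \<open>1 - e\<close>. The choice will be
  \<open>e = 1 / (2 * m)\<close>.\<close>

lemma perturbed_density_affinity:
  fixes f h :: "real \<Rightarrow> real"
  assumes f: "integrable circle f" "(\<integral>t. f t \<partial>circle) = 1" "\<And>t. 1 / 2 \<le> f t"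
    and h: "\<And>t. \<bar>h t\<bar> \<le> 1 / 2" "\<And>t. 2 * (h t)\<^sup>2 \<le> e" and e: "0 \<le> e" "e \<le> 1 / 2"
  shows "ennreal (1 - e) \<le> (\<integral>\<^sup>+t. ennreal (sqrt ((f t + h t) * (f t - h t))) \<partial>circle)"
proof -
  have "f t - e \<le> sqrt ((f t + h t) * (f t - h t))" for t
  proof (rule real_le_rsqrt)
    have "e \<le> 2 * (f t * e)" using f(3)[of t] e mult_right_mono[of "1/2" "f t" e] by simp
    moreover have "e\<^sup>2 \<le> f t * e"
      unfolding power2_eq_square using f(3)[of t] e by (intro mult_right_mono) auto
    moreover have "(f t - e)\<^sup>2 = (f t)\<^sup>2 - 2 * (f t * e) + e\<^sup>2" by (simp add: power2_diff)
    moreover have "(f t + h t) * (f t - h t) = (f t)\<^sup>2 - (h t)\<^sup>2" by (simp add: power2_eq_square algebra_simps)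
    ultimately show "(f t - e)\<^sup>2 \<le> (f t + h t) * (f t - h t)" using h(2)[of t] by linarith
  qed
  then have "(\<integral>\<^sup>+t. ennreal (f t - e) \<partial>circle) \<le> (\<integral>\<^sup>+t. ennreal (sqrt ((f t + h t) * (f t - h t))) \<partial>circle)"
    by (intro nn_integral_mono ennreal_leI)
  moreover have "(\<integral>\<^sup>+t. ennreal (f t - e) \<partial>circle) = ennreal (\<integral>t. f t - e \<partial>circle)"
  proof (rule nn_integral_eq_integral)
    show "AE t in circle. 0 \<le> f t - e"
    proof (intro AE_I2)
      show "0 \<le> f t - e" for t using f(3)[of t] e by linarith
    qed
  qed (use f(1) in simp)
  moreover have "(\<integral>t. f t - e \<partial>circle) = 1 - e"
    using f(1,2) circle.prob_space by simp
  ultimately show ?thesis by simp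
qed

lemma (in shifted_poisson_model) observation_law:
  assumes m: "m \<ge> 1"
  shows "(\<lambda>w. (\<lambda>i\<in>{1..n}. N i w, \<lambda>k\<in>{1..m}. Y k w)) \<in> measurable P (observation_space n m)"
    and "distr P (observation_space n m) (\<lambda>w. (\<lambda>i\<in>{1..n}. N i w, \<lambda>k\<in>{1..m}. Y k w)) =
      distr P (PiM {1..n} (\<lambda>_. configurations circle)) (\<lambda>w. \<lambda>i\<in>{1..n}. N i w) \<Otimes>\<^sub>M
      PiM {1..m} (\<lambda>_. density circle (\<lambda>t. ennreal (f t)))"
proof -
  have Y: "Y k \<in> measurable P circle" "distr P circle (Y k) = density circle (\<lambda>t. ennreal (f t))"
    if "k \<in> {1..m}" for k
    using sample_density[OF that] by (simp_all add: distributed_def)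
  have Ym: "(\<lambda>w. \<lambda>k\<in>{1..m}. Y k w) \<in> measurable P (PiM {1..m} (\<lambda>_. circle))"
    by (intro measurable_restrict Y)
  show "(\<lambda>w. (\<lambda>i\<in>{1..n}. N i w, \<lambda>k\<in>{1..m}. Y k w)) \<in> measurable P (observation_space n m)"
    unfolding observation_space_def by (intro measurable_Pair observed_vector_measurable Ym)
  have "distr P (PiM {1..m} (\<lambda>_. circle)) (\<lambda>w. \<lambda>k\<in>{1..m}. Y k w) = PiM {1..m} (\<lambda>k. distr P circle (Y k))"
    using m by (intro indep_vars_iff_distr_eq_PiM'[THEN iffD1] sample_indep) (auto intro: Y)
  also have "\<dots> = PiM {1..m} (\<lambda>_. density circle (\<lambda>t. ennreal (f t)))"
    by (intro PiM_cong refl Y)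
  finally show "distr P (observation_space n m) (\<lambda>w. (\<lambda>i\<in>{1..n}. N i w, \<lambda>k\<in>{1..m}. Y k w)) =
      distr P (PiM {1..n} (\<lambda>_. configurations circle)) (\<lambda>w. \<lambda>i\<in>{1..n}. N i w) \<Otimes>\<^sub>M
      PiM {1..m} (\<lambda>_. density circle (\<lambda>t. ennreal (f t)))"
    unfolding observation_space_def
    by (subst indep_set_joint_distr[OF observed_vector_measurable Ym sample_indep_observed]) simp
qed

section \<open>The lower bound\<close>

text \<open>An estimate \<open>z\<close> cannot be close to both targets: triangle inequality, then
  \<open>(s + t)^2 \<le> 2 * s^2 + 2 * t^2\<close>.\<close>

lemma cmod_parallelogram_ge: "(cmod (u - v))\<^sup>2 / 2 \<le> (cmod (z - u))\<^sup>2 + (cmod (z - v))\<^sup>2"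
proof -
  have "cmod (u - v) \<le> cmod (z - u) + cmod (z - v)"
    using norm_triangle_ineq4[of "z - v" "z - u"] by simp
  then have "(cmod (u - v))\<^sup>2 \<le> (cmod (z - u) + cmod (z - v))\<^sup>2" by (intro power_mono) simp_all
  also have "\<dots> \<le> 2 * ((cmod (z - u))\<^sup>2 + (cmod (z - v))\<^sup>2)"
    using zero_le_power2[of "cmod (z - u) - cmod (z - v)"] by (simp add: power2_diff power2_sum)
  finally show ?thesis by simp
qed

text \<open>The share of the squared \<omega>-norm of \<open>g - lam\<close> carried by
  \<open>k\<close> and \<open>- k\<close>. It involves only coordinates whose measurability
  \<open>estimators\<close> provides; keeping both frequencies doubles the separation.\<close>

definition coefficient_loss :: "(int \<Rightarrow> real) \<Rightarrow> int \<Rightarrow> (real \<Rightarrow> real) \<Rightarrow> (real \<Rightarrow> complex) \<Rightarrow> real" where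
  "coefficient_loss \<omega> k lam g =
    \<omega> k * (cmod (fourier_coeff g k - fourier_coeff (\<lambda>t. of_real (lam t)) k))\<^sup>2 +
    \<omega> (- k) * (cmod (fourier_coeff g (- k) - fourier_coeff (\<lambda>t. of_real (lam t)) (- k)))\<^sup>2"

lemma coefficient_loss_measurable:
  assumes "est \<in> estimators n m"
  shows "(\<lambda>z. ennreal (coefficient_loss \<omega> k lam (est z))) \<in> borel_measurable (observation_space n m)"
proof -
  have [measurable]: "(\<lambda>z. fourier_coeff (est z) j) \<in> borel_measurable (observation_space n m)" for j
    using assms by (simp add: estimators_def)
  show ?thesis unfolding coefficient_loss_def by measurable
qed

text \<open>Restricted to two coordinates the loss is a measurable function of the observations, so
  its expectation is an integral over their joint law, which is a product.\<close>

lemma (in shifted_poisson_model) risk_ge_coefficient_loss: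
  assumes m: "m \<ge> 1" and est: "est \<in> estimators n m" and lam': "lam' \<in> L2"
    and \<omega>: "\<And>j. 0 < \<omega> j" and k: "k \<noteq> 0"
  shows "(\<integral>\<^sup>+z. ennreal (coefficient_loss \<omega> k lam' (est z))
      \<partial>(distr P (PiM {1..n} (\<lambda>_. configurations circle)) (\<lambda>w. \<lambda>i\<in>{1..n}. N i w) \<Otimes>\<^sub>M
         PiM {1..m} (\<lambda>_. density circle (\<lambda>t. ennreal (f t))))) \<le> risk \<omega> P n m N Y est lam'"
  unfolding observation_law(2)[OF m, symmetric] risk_def
proof (subst nn_integral_distr[OF observation_law(1)[OF m]])
  show "(\<lambda>z. ennreal (coefficient_loss \<omega> k lam' (est z))) \<in> borel_measurable (distr P (observation_space n m)
      (\<lambda>w. (\<lambda>i\<in>{1..n}. N i w, \<lambda>k\<in>{1..m}. Y k w)))"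
    using coefficient_loss_measurable[OF est] by simp
next
  show "(\<integral>\<^sup>+w. ennreal (coefficient_loss \<omega> k lam' (est (\<lambda>i\<in>{1..n}. N i w, \<lambda>k\<in>{1..m}. Y k w))) \<partial>P) \<le>
      (\<integral>\<^sup>+w. weighted_norm_sq \<omega> (\<lambda>t. est (\<lambda>i\<in>{1..n}. N i w, \<lambda>k\<in>{1..m}. Y k w) t - of_real (lam' t)) \<partial>P)"
  proof (intro nn_integral_mono)
    fix w assume w: "w \<in> space P"
    let ?z = "(\<lambda>i\<in>{1..n}. N i w, \<lambda>k\<in>{1..m}. Y k w)"
    have "est ?z \<in> L2"
      using est measurable_space[OF observation_law(1)[OF m] w] by (simp add: estimators_def)
    then have "fourier_coeff (\<lambda>t. est ?z t - of_real (lam' t)) j =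
        fourier_coeff (est ?z) j - fourier_coeff (\<lambda>t. of_real (lam' t)) j" for j
      using lam' by (intro fourier_coeff_diff L2_integrable) (simp_all add: of_real_mem_L2_iff)
    moreover have "k \<noteq> - k" using k by simp
    ultimately show "ennreal (coefficient_loss \<omega> k lam' (est ?z)) \<le>
        weighted_norm_sq \<omega> (\<lambda>t. est ?z t - of_real (lam' t))"
      using weighted_norm_sq_ge_two_terms[of k "- k" \<omega> "\<lambda>t. est ?z t - of_real (lam' t)"]
        less_imp_le[OF \<omega>] by (simp add: coefficient_loss_def)
  qed
qed

text \<open>Origin of 1/32: the losses at the two hypotheses add up to at least
  \<open>\<omega> k * 4 * a^2 * b^2\<close>, the overlap contributes 1/8, bounding two risks by one
  supremum contributes 1/2, and \<open>b^2\<close> contains another 1/8.\<close>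

lemma minimax_risk_ge_frequency:
  fixes P :: "(real \<Rightarrow> real) \<Rightarrow> (real \<Rightarrow> real) \<Rightarrow> 'a measure" and D \<zeta> r :: real and k :: int
  assumes r: "0 < r" and D: "1 \<le> D" and n: "n \<ge> 1" and m: "m \<ge> 1" and k: "k \<noteq> 0"
    and \<gamma>: "\<And>j. 0 < \<gamma> j" "\<gamma> 0 = 1" "\<gamma> (- k) = \<gamma> k" "1 \<le> \<gamma> k"
    and \<alpha>: "\<And>j. 0 < \<alpha> j" "\<alpha> k \<le> 1"
    and \<omega>: "\<And>j. 0 < \<omega> j" "\<omega> (- k) = \<omega> k"
    and f: "f \<in> F_class \<alpha> (D\<^sup>2)" "\<And>t. 1 / 2 \<le> f t"
    and \<zeta>: "0 \<le> \<zeta>" "\<zeta> \<le> 1 / (4 * D\<^sup>2)" "\<zeta> \<le> 1 - 1 / D"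
    and model: "\<And>lam f. lam \<in> Lambda_class \<gamma> r \<Longrightarrow> f \<in> F_class \<alpha> (D ^ 4) \<Longrightarrow>
      \<exists>K x \<epsilon>. shifted_poisson_model (P lam f) n m lam f K x \<epsilon> N Y"
    and est: "est \<in> estimators n m"
  shows "ennreal (\<omega> k / \<gamma> k * min 1 (1 / (m * \<alpha> k)) * \<zeta>\<^sup>2 * r / D\<^sup>2 / 32) \<le>
    (SUP lam\<in>Lambda_class \<gamma> r. SUP f\<in>F_class \<alpha> (D ^ 4). risk \<omega> (P lam f) n m N Y est lam)"
    (is "_ \<le> ?S")
proof -
  define \<mu> where "\<mu> = min 1 (1 / (m * \<alpha> k))"
  have \<mu>: "0 \<le> \<mu>" "\<mu> \<le> 1" "\<mu> * \<alpha> k \<le> 1 / m"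
  proof -
    show "0 \<le> \<mu>" "\<mu> \<le> 1" using \<alpha>(1)[of k] by (simp_all add: \<mu>_def)
    have "\<mu> * \<alpha> k \<le> 1 / (m * \<alpha> k) * \<alpha> k" using \<alpha>(1)[of k] by (intro mult_right_mono) (simp_all add: \<mu>_def)
    then show "\<mu> * \<alpha> k \<le> 1 / m" using \<alpha>(1)[of k] by simp
  qed
  \<comment> \<open>Since \<open>\<mu> \<le> 1\<close>, this keeps \<open>a\<close> within
    \<open>\<zeta>\<close>; since \<open>\<mu> * \<alpha> k \<le> 1 / m\<close>, it makes the
    squared perturbation of the density, of order \<open>a^2 * \<alpha> k\<close>, at most of order
    \<open>1 / m\<close>.\<close>
  define a where "a = \<zeta> * sqrt \<mu>"
  have a: "0 \<le> a" "a \<le> \<zeta>" "a\<^sup>2 = \<zeta>\<^sup>2 * \<mu>"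
    using \<zeta>(1) \<mu>(1,2) by (simp_all add: a_def power_mult_distrib mult_left_le)
  \<comment> \<open>Chosen so that \<open>|1 - \<tau>| \<le> D\<close> gives
    \<open>(B \<tau>)^2 \<le> r / (2 * \<gamma> k)\<close>. With \<open>\<gamma> k \<ge> 1\<close>
    this yields \<open>|B \<tau>| \<le> sqrt (r / 2)\<close> and hence a non-negative intensity; in
    the budget \<open>r\<close> the constant term costs \<open>r / 2\<close> and the cosine at most
    \<open>r / 4\<close>.\<close>
  define b where "b = sqrt (r / (8 * \<gamma> k)) / D"
  have b2: "b\<^sup>2 = r / (8 * \<gamma> k * D\<^sup>2)"
    using r \<gamma>(1)[of k] by (simp add: b_def power_divide real_sqrt_pow2)
  define F where "F = fourier_coeff (\<lambda>t. of_real (f t)) k"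
  define g where "g \<tau> t = f t + 2 * Re (of_real \<tau> * F * trig k t)" for \<tau> t
  \<comment> \<open>The factor 2 is shared between \<open>k\<close> and \<open>- k\<close>, which
    leaves the coefficient \<open>(1 - \<tau>) * b\<close> at each.\<close>
  define B where "B \<tau> = 2 * (1 - \<tau>) * b" for \<tau> :: real
  define lam where "lam \<tau> t = sqrt (r / 2) + Re (of_real (B \<tau>) * trig k t)" for \<tau> t
  have g: "g \<tau> \<in> F_class \<alpha> (D ^ 4)" "\<And>t. 0 \<le> g \<tau> t"
      "fourier_coeff (\<lambda>t. of_real (g \<tau> t)) k = (1 + of_real \<tau>) * F"
    and tF: "\<tau>\<^sup>2 * (cmod F)\<^sup>2 \<le> \<tau>\<^sup>2 * (D\<^sup>2 * \<alpha> k)" "cmod (of_real \<tau> * F) \<le> 1 / 4"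
    if "\<bar>\<tau>\<bar> = a" for \<tau>
    using perturbed_density_mem_F_class[OF D f k \<alpha> _ \<zeta>(2,3), of \<tau>] that a(2)
    by (simp_all add: g_def[abs_def] F_def)
  have lam: "lam \<tau> \<in> Lambda_class \<gamma> r" "\<And>t. 0 \<le> lam \<tau> t"
      "fourier_coeff (\<lambda>t. of_real (lam \<tau> t)) k = of_real ((1 - \<tau>) * b)"
      "fourier_coeff (\<lambda>t. of_real (lam \<tau> t)) (- k) = of_real ((1 - \<tau>) * b)"
    if \<tau>: "\<bar>\<tau>\<bar> = a" for \<tau>
  proof -
    have "2 - 1 / D \<le> D"
      using D zero_le_power2[of "D - 1"] by (simp add: field_simps power2_eq_square)
    then have "\<bar>1 - \<tau>\<bar> \<le> D" using \<tau> a(2) \<zeta>(3) by linarith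
    then have "(1 - \<tau>)\<^sup>2 \<le> D\<^sup>2" using D by (intro abs_le_square_iff[THEN iffD1]) simp
    then have "4 * b\<^sup>2 * (1 - \<tau>)\<^sup>2 \<le> 4 * b\<^sup>2 * D\<^sup>2" by (intro mult_left_mono) simp_all
    also have "\<dots> = r / (2 * \<gamma> k)" using D by (simp add: b2)
    finally have B2: "(B \<tau>)\<^sup>2 \<le> r / (2 * \<gamma> k)" unfolding B_def power_mult_distrib by (simp only: mult_ac) simp
    also have "\<dots> \<le> r / 2" using r \<gamma>(4) by (simp add: field_simps)
    finally have "\<bar>B \<tau>\<bar> \<le> sqrt (r / 2)" by (intro real_le_rsqrt) simp
    then have pos: "0 \<le> sqrt (r / 2) + Re (of_real (B \<tau>) * trig k t)" for t
      using real_trig_bound[of "of_real (B \<tau>)" k t] unfolding norm_of_real by linarith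
    have "\<gamma> k * (B \<tau>)\<^sup>2 / 2 \<le> r / 4" using B2 \<gamma>(1)[of k] by (simp add: field_simps)
    then have "(sqrt (r / 2))\<^sup>2 + \<gamma> k * (B \<tau>)\<^sup>2 / 2 \<le> r" using r by simp
    note cls = trig_polynomial_mem_Lambda_class[OF k pos \<gamma>(1-3) this]
    show "lam \<tau> \<in> Lambda_class \<gamma> r" using cls(1) by (simp add: lam_def[abs_def])
    show "0 \<le> lam \<tau> t" for t using pos by (simp add: lam_def)
    show "fourier_coeff (\<lambda>t. of_real (lam \<tau> t)) k = of_real ((1 - \<tau>) * b)"
      "fourier_coeff (\<lambda>t. of_real (lam \<tau> t)) (- k) = of_real ((1 - \<tau>) * b)"
      unfolding lam_def cls(2) using k by (auto simp: B_def)
  qed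
  have gF: "g \<tau> \<in> L2" "AE t in circle. 0 \<le> g \<tau> t" "fourier_coeff (\<lambda>t. of_real (g \<tau> t)) 0 = 1"
    if "\<bar>\<tau>\<bar> = a" for \<tau>
    using g(1)[OF that] by (simp_all add: F_class_def)
  have functional: "(\<integral>y. smoothed (g \<tau>) u y - 1 \<partial>density circle (\<lambda>t. ennreal (lam \<tau> t))) =
      sqrt (r / 2) * (\<integral>t. u t - 1 \<partial>circle) +
      Re (of_real (2 * (1 - a\<^sup>2) * b) * F * (\<integral>t. complex_of_real (u t - 1) * trig k t \<partial>circle))"
    if \<tau>: "\<bar>\<tau>\<bar> = a" and u: "u \<in> borel_measurable circle" "\<And>y. 0 \<le> u y \<and> u y \<le> 1" for \<tau> u
  proof -
    have "\<bar>u y - 1\<bar> \<le> 1" for y using u(2)[of y] by auto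
    then have "(\<integral>y. smoothed (g \<tau>) (\<lambda>t. u t - 1) y \<partial>density circle (\<lambda>t. ennreal (lam \<tau> t))) =
        sqrt (r / 2) * (\<integral>t. u t - 1 \<partial>circle) +
        Re (of_real (B \<tau>) * fourier_coeff (\<lambda>t. of_real (g \<tau> t)) k * (\<integral>t. complex_of_real (u t - 1) * trig k t \<partial>circle))"
      using u(1) lam(2)[OF \<tau>] unfolding lam_def
      by (intro smoothed_trig_integral gF[OF \<tau>]) auto
    moreover have "of_real (B \<tau>) * fourier_coeff (\<lambda>t. of_real (g \<tau> t)) k = of_real (2 * (1 - a\<^sup>2) * b) * F"
      unfolding g(3)[OF \<tau>] using \<tau> power2_abs[of \<tau>] by (simp add: B_def algebra_simps power2_eq_square)
    ultimately show ?thesis unfolding smoothed_minus_one[OF gF[OF \<tau>] u] by (simp only:)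
  qed
  have pm: "\<bar>a\<bar> = a" "\<bar>- a\<bar> = a" using a(1) by simp_all
  let ?T = "PiM {1..n} (\<lambda>_. configurations circle)" and ?N = "\<lambda>w. \<lambda>i\<in>{1..n}. N i w"
  define Q where "Q = distr (P (lam a) (g a)) ?T ?N"
  obtain K x \<epsilon> where M1: "shifted_poisson_model (P (lam a) (g a)) n m (lam a) (g a) K x \<epsilon> N Y"
    using model[OF lam(1) g(1), OF pm(1) pm(1)] by blast
  obtain K' x' \<epsilon>' where M2: "shifted_poisson_model (P (lam (- a)) (g (- a))) n m (lam (- a)) (g (- a)) K' x' \<epsilon>' N Y"
    using model[OF lam(1) g(1), OF pm(2) pm(2)] by blast
  interpret M1: shifted_poisson_model "P (lam a) (g a)" n m "lam a" "g a" K x \<epsilon> N Y by (fact M1)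
  interpret M2: shifted_poisson_model "P (lam (- a)) (g (- a))" n m "lam (- a)" "g (- a)" K' x' \<epsilon>' N Y by (fact M2)
  have Q': "Q = distr (P (lam (- a)) (g (- a))) ?T ?N"
    unfolding Q_def using functional pm by (intro observed_law_eqI[OF M1 M2 n]) (simp only:)
  have Qprob: "prob_space Q" unfolding Q_def by (rule M1.prob_space_distr[OF M1.observed_vector_measurable])
  have sQ: "sets (Q \<Otimes>\<^sub>M PiM {1..m} (\<lambda>_. circle)) = sets (observation_space n m)"
    unfolding observation_space_def Q_def by (intro sets_pair_measure_cong) simp_all
  let ?loss = "\<lambda>\<tau> z. ennreal (coefficient_loss \<omega> k (lam \<tau>) (est z))"
  have "ennreal (\<omega> k * (4 * a\<^sup>2 * b\<^sup>2)) * ennreal (1 / 8) \<le>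
      (\<integral>\<^sup>+z. ?loss a z \<partial>(Q \<Otimes>\<^sub>M PiM {1..m} (\<lambda>_. density circle (\<lambda>t. ennreal (g a t))))) +
      (\<integral>\<^sup>+z. ?loss (- a) z \<partial>(Q \<Otimes>\<^sub>M PiM {1..m} (\<lambda>_. density circle (\<lambda>t. ennreal (g (- a) t)))))"
  proof (rule two_point_bound)
    have gp: "g \<tau> \<in> borel_measurable circle" "0 \<le> g \<tau> t" "(\<integral>\<^sup>+t. ennreal (g \<tau> t) \<partial>circle) = 1"
      if \<tau>: "\<bar>\<tau>\<bar> = a" for \<tau> t
    proof -
      show gm[measurable]: "g \<tau> \<in> borel_measurable circle" using gF(1)[OF \<tau>] by (simp add: L2_def)
      show "0 \<le> g \<tau> t" by (rule g(2)[OF \<tau>])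
      interpret G: prob_space "density circle (\<lambda>t. ennreal (g \<tau> t))"
        by (rule prob_space_density_circle[OF gF[OF \<tau>]])
      have "1 = (\<integral>\<^sup>+t. 1 \<partial>density circle (\<lambda>t. ennreal (g \<tau> t)))"
        using G.emeasure_space_1 by (simp only: nn_integral_const mult_1_left)
      also have "\<dots> = (\<integral>\<^sup>+t. ennreal (g \<tau> t) \<partial>circle)" by (subst nn_integral_density) simp_all
      finally show "(\<integral>\<^sup>+t. ennreal (g \<tau> t) \<partial>circle) = 1" by simp
    qed
    show "g a \<in> borel_measurable circle" "0 \<le> g a t" "(\<integral>\<^sup>+t. ennreal (g a t) \<partial>circle) = 1"
      "g (- a) \<in> borel_measurable circle" "0 \<le> g (- a) t" "(\<integral>\<^sup>+t. ennreal (g (- a) t) \<partial>circle) = 1" for t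
      by (rule gp[OF pm(1)] gp[OF pm(2)])+
    have fcls: "f \<in> L2" "fourier_coeff (\<lambda>t. of_real (f t)) 0 = 1" using f(1) by (simp_all add: F_class_def)
    define h where "h t = 2 * Re (of_real a * F * trig k t)" for t
    have h1: "\<bar>h t\<bar> \<le> 2 * cmod (of_real a * F)" for t
      using real_trig_bound[of "of_real a * F" k t] unfolding h_def abs_mult by simp
    have "ennreal (1 - 1 / (2 * card {1..m})) \<le> (\<integral>\<^sup>+t. ennreal (sqrt ((f t + h t) * (f t - h t))) \<partial>circle)"
    proof (rule perturbed_density_affinity)
      show "integrable circle f" by (rule L2_integrable[OF fcls(1)])
      have "complex_of_real (\<integral>t. f t \<partial>circle) = 1"
        using fcls(2) by (simp add: fourier_coeff_def integral_complex_of_real)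
      then show "(\<integral>t. f t \<partial>circle) = 1" by (simp only: of_real_eq_1_iff)
      show "\<bar>h t\<bar> \<le> 1 / 2" for t using h1[of t] tF(2)[OF pm(1)] by linarith
      show "2 * (h t)\<^sup>2 \<le> 1 / (2 * card {1..m})" for t
      proof -
        have "(h t)\<^sup>2 \<le> (2 * cmod (of_real a * F))\<^sup>2" using h1[of t] by (intro abs_le_square_iff[THEN iffD1]) simp
        then have "2 * (h t)\<^sup>2 \<le> 8 * (a\<^sup>2 * (cmod F)\<^sup>2)" by (simp add: norm_mult power_mult_distrib)
        also have "\<dots> \<le> 8 * (a\<^sup>2 * (D\<^sup>2 * \<alpha> k))" using tF(1)[OF pm(1)] by simp
        also have "\<dots> = 8 * D\<^sup>2 * \<zeta>\<^sup>2 * (\<mu> * \<alpha> k)" by (simp add: a(3))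
        \<comment> \<open>By \<open>\<zeta> \<le> 1 / (4 * D^2)\<close> the factor
          \<open>8 * D^2 * \<zeta>^2\<close> is at most \<open>1 / (2 * D^2)\<close>; the 4 in
          \<open>\<zeta>\<close> thus produces the \<open>1 / (2 * m)\<close> that the affinity
          bound asks for.\<close>
        also have "\<dots> \<le> 8 * D\<^sup>2 * (1 / (4 * D\<^sup>2))\<^sup>2 * (1 / m)"
          using D \<zeta>(1,2) \<mu>(1,3) \<alpha>(1)[of k] by (intro mult_mono power_mono) simp_all
        also have "\<dots> = 1 / (2 * D\<^sup>2 * m)" using D m by (simp add: field_simps power2_eq_square)
        also have "\<dots> \<le> 1 / (2 * m)" using D m by (intro divide_left_mono) simp_all
        finally show ?thesis by simp
      qed
    qed (use f(2) m in \<open>simp_all add: field_simps\<close>)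
    moreover have "g a t = f t + h t" "g (- a) t = f t - h t" for t by (simp_all add: g_def h_def)
    ultimately show "ennreal (1 - 1 / (2 * card {1..m})) \<le> (\<integral>\<^sup>+t. ennreal (sqrt (g a t * g (- a) t)) \<partial>circle)"
      by (simp only:)
    show "?loss a \<in> borel_measurable (Q \<Otimes>\<^sub>M PiM {1..m} (\<lambda>_. circle))"
      "?loss (- a) \<in> borel_measurable (Q \<Otimes>\<^sub>M PiM {1..m} (\<lambda>_. circle))"
      unfolding measurable_cong_sets[OF sQ refl] by (rule coefficient_loss_measurable[OF est])+
    fix z
    \<comment> \<open>The targets are \<open>2 * a * b\<close> apart, so half their squared
      distance, \<open>2 * a^2 * b^2\<close>, is collected once at \<open>k\<close> and once at
      \<open>- k\<close>.\<close>
    have "(cmod (of_real ((1 - a) * b) - of_real ((1 - - a) * b)))\<^sup>2 = 4 * a\<^sup>2 * b\<^sup>2"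
      unfolding of_real_diff[symmetric] norm_of_real power2_abs by (simp add: power2_eq_square algebra_simps)
    then have two: "2 * a\<^sup>2 * b\<^sup>2 \<le> (cmod (y - of_real ((1 - a) * b)))\<^sup>2 + (cmod (y - of_real ((1 - - a) * b)))\<^sup>2" for y
      using cmod_parallelogram_ge[of "of_real ((1 - a) * b)" "of_real ((1 - - a) * b)" y] by simp
    have "coefficient_loss \<omega> k (lam a) (est z) + coefficient_loss \<omega> k (lam (- a)) (est z) =
        \<omega> k * ((cmod (fourier_coeff (est z) k - of_real ((1 - a) * b)))\<^sup>2 + (cmod (fourier_coeff (est z) k - of_real ((1 - - a) * b)))\<^sup>2) +
        \<omega> k * ((cmod (fourier_coeff (est z) (- k) - of_real ((1 - a) * b)))\<^sup>2 + (cmod (fourier_coeff (est z) (- k) - of_real ((1 - - a) * b)))\<^sup>2)"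
      unfolding coefficient_loss_def lam(3)[OF pm(1)] lam(3)[OF pm(2)] lam(4)[OF pm(1)] lam(4)[OF pm(2)] \<omega>(2)
      by (simp only: distrib_left add_ac)
    also have "\<dots> \<ge> \<omega> k * (2 * a\<^sup>2 * b\<^sup>2) + \<omega> k * (2 * a\<^sup>2 * b\<^sup>2)"
      using \<omega>(1)[of k] by (intro add_mono mult_left_mono two) simp_all
    finally have "\<omega> k * (4 * a\<^sup>2 * b\<^sup>2) \<le> coefficient_loss \<omega> k (lam a) (est z) + coefficient_loss \<omega> k (lam (- a)) (est z)"
      by simp
    moreover have "0 \<le> coefficient_loss \<omega> k l y" for l y
      using less_imp_le[OF \<omega>(1)] by (simp add: coefficient_loss_def)
    ultimately show "ennreal (\<omega> k * (4 * a\<^sup>2 * b\<^sup>2)) \<le> ?loss a z + ?loss (- a) z"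
      by (simp add: ennreal_plus[symmetric] ennreal_leI del: ennreal_plus)
  qed (use Qprob m circle.sigma_finite_measure_axioms pm in simp_all)
  also have "\<dots> \<le> risk \<omega> (P (lam a) (g a)) n m N Y est (lam a) + risk \<omega> (P (lam (- a)) (g (- a))) n m N Y est (lam (- a))"
  proof (rule add_mono)
    have L2: "lam \<tau> \<in> L2" if "\<bar>\<tau>\<bar> = a" for \<tau> using lam(1)[OF that] by (simp add: Lambda_class_def)
    show "(\<integral>\<^sup>+z. ?loss a z \<partial>(Q \<Otimes>\<^sub>M PiM {1..m} (\<lambda>_. density circle (\<lambda>t. ennreal (g a t))))) \<le>
        risk \<omega> (P (lam a) (g a)) n m N Y est (lam a)"
      unfolding Q_def by (rule M1.risk_ge_coefficient_loss[OF m est L2[OF pm(1)] \<omega>(1) k])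
    show "(\<integral>\<^sup>+z. ?loss (- a) z \<partial>(Q \<Otimes>\<^sub>M PiM {1..m} (\<lambda>_. density circle (\<lambda>t. ennreal (g (- a) t))))) \<le>
        risk \<omega> (P (lam (- a)) (g (- a))) n m N Y est (lam (- a))"
      unfolding Q' by (rule M2.risk_ge_coefficient_loss[OF m est L2[OF pm(2)] \<omega>(1) k])
  qed
  also have "\<dots> \<le> ?S + ?S"
  proof -
    have "risk \<omega> (P (lam \<tau>) (g \<tau>)) n m N Y est (lam \<tau>) \<le> ?S" if "\<bar>\<tau>\<bar> = a" for \<tau>
      by (rule SUP_upper2[OF lam(1)[OF that]], rule SUP_upper[OF g(1)[OF that]])
    then show ?thesis using pm by (intro add_mono) simp_all
  qed
  finally have le: "ennreal (\<omega> k * (4 * a\<^sup>2 * b\<^sup>2)) * ennreal (1 / 8) \<le> ?S + ?S" .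
  have c0: "0 \<le> \<omega> k * (4 * a\<^sup>2 * b\<^sup>2)" using \<omega>(1)[of k] by simp
  have "ennreal (\<omega> k * (4 * a\<^sup>2 * b\<^sup>2) / 16) \<le> ?S"
  proof (cases ?S)
    case (real s)
    have "ennreal (\<omega> k * (4 * a\<^sup>2 * b\<^sup>2) * (1 / 8)) \<le> ennreal (s + s)"
      using le real c0 by (simp add: ennreal_mult[symmetric] ennreal_plus[symmetric] del: ennreal_plus)
    then have "\<omega> k * (4 * a\<^sup>2 * b\<^sup>2) * (1 / 8) \<le> s + s" using real by (subst (asm) ennreal_le_iff) simp_all
    then show ?thesis using real by (simp add: ennreal_leI)
  next
    case top
    show ?thesis unfolding top by (rule top_greatest)
  qed
  moreover have "\<omega> k * (4 * a\<^sup>2 * b\<^sup>2) / 16 = \<omega> k / \<gamma> k * \<mu> * \<zeta>\<^sup>2 * r / D\<^sup>2 / 32"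
    using D \<gamma>(1)[of k] by (simp add: a(3) b2 field_simps)
  ultimately show ?thesis by (simp only: \<mu>_def)
qed

theorem theorem3p3:
  fixes r d :: real and \<gamma> \<alpha> \<omega> :: "int \<Rightarrow> real" and n m :: nat
    and P :: "(real \<Rightarrow> real) \<Rightarrow> (real \<Rightarrow> real) \<Rightarrow> 'a measure"
    and N :: "nat \<Rightarrow> 'a \<Rightarrow> real multiset" and Y :: "nat \<Rightarrow> 'a \<Rightarrow> real"
  assumes "r > 0" and "d \<ge> 1" and "n \<ge> 1" and "m \<ge> 1"
    and "\<And>j. \<gamma> j > 0" and "\<And>j. \<alpha> j > 0" and "\<And>j. \<omega> j > 0"
    and "\<And>j. \<gamma> (- j) = \<gamma> j" and "\<And>j. \<alpha> (- j) = \<alpha> j" and "\<And>j. \<omega> (- j) = \<omega> j"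
    and "\<gamma> 0 = 1" and "\<alpha> 0 = 1" and "\<omega> 0 = 1"
    and "\<And>j. \<gamma> j \<ge> 1"
    and "decseq (\<lambda>k. \<omega> (int k) / \<gamma> (int k))" and "decseq (\<lambda>k. \<alpha> (int k))"
    and "\<alpha> summable_on UNIV"
    and "\<exists>f\<in>F_class \<alpha> (sqrt d). AE t in circle. f t \<ge> 1 / 2"
    and model: "\<And>lam f. lam \<in> Lambda_class \<gamma> r \<Longrightarrow> f \<in> F_class \<alpha> d \<Longrightarrow>
      \<exists>K x \<epsilon>. shifted_poisson_model (P lam f) n m lam f K x \<epsilon> N Y"
  defines "\<zeta> \<equiv> min (1 / (4 * sqrt d)) (1 - d powr (- 1 / 4))"
  shows "(INF est\<in>estimators n m. SUP lam\<in>Lambda_class \<gamma> r. SUP f\<in>F_class \<alpha> d.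
            risk \<omega> (P lam f) n m N Y est lam)
         \<ge> ennreal ((1 - sqrt 3 / 2) / 8 * \<zeta>\<^sup>2 * r * d powr (- 1 / 2) * Phi \<omega> \<gamma> \<alpha> m)"
proof (rule INF_greatest)
  fix est assume est: "est \<in> estimators n m"
  let ?S = "SUP lam\<in>Lambda_class \<gamma> r. SUP f\<in>F_class \<alpha> d. risk \<omega> (P lam f) n m N Y est lam"
  define D where "D = d powr (1 / 4)"
  have D: "1 \<le> D" "D ^ 4 = d" "D\<^sup>2 = sqrt d"
  proof -
    show "1 \<le> D" "D ^ 4 = d"
      using \<open>d \<ge> 1\<close> by (simp_all add: D_def ge_one_powr_ge_zero powr_realpow[symmetric] powr_powr)
    have "D\<^sup>2 = d powr (1 / 2)" by (simp add: D_def power2_eq_square powr_add[symmetric])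
    then show "D\<^sup>2 = sqrt d" using \<open>d \<ge> 1\<close> by (simp add: powr_half_sqrt)
  qed
  have inv: "d powr (- 1 / 4) = 1 / D" "d powr (- 1 / 2) = 1 / D\<^sup>2"
    using \<open>d \<ge> 1\<close> by (simp add: D_def powr_minus_divide, simp add: D(3) powr_minus_divide powr_half_sqrt)
  have \<zeta>: "0 \<le> \<zeta>" "\<zeta> \<le> 1 / (4 * D\<^sup>2)" "\<zeta> \<le> 1 - 1 / D"
    unfolding \<zeta>_def D(3)[symmetric] inv using D(1) by (simp_all add: field_simps)
  define C where "C = (1 - sqrt 3 / 2) / 8 * \<zeta>\<^sup>2 * r * d powr (- 1 / 2)"
  \<comment> \<open>The passage from the constant 1/32 at each frequency to the stated one:
    \<open>(1 - sqrt 3 / 2) / 8 \<le> 1 / 32\<close> amounts to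
    \<open>3 / 2 \<le> sqrt 3\<close>.\<close>
  have "3 / 2 \<le> sqrt 3" by (rule real_le_rsqrt) (simp add: power2_eq_square)
  then have s3: "(1 - sqrt 3 / 2) / 8 \<le> 1 / 32" by simp
  have "sqrt 3 \<le> 2" by (rule real_le_lsqrt) simp_all
  then have C0: "0 \<le> C" using \<open>r > 0\<close> by (simp add: C_def)
  obtain f where f: "f \<in> F_class \<alpha> (sqrt d)" "\<And>t. 1 / 2 \<le> f t"
    using F_class_bounded_below_version assms(18) by blast
  have \<alpha>1: "\<alpha> (int k) \<le> 1" for k
    using decseqD[OF \<open>decseq (\<lambda>k. \<alpha> (int k))\<close>, of 0 k] \<open>\<alpha> 0 = 1\<close> by simp
  let ?t = "\<lambda>k. \<omega> (int k) / \<gamma> (int k) * min 1 (1 / (real m * \<alpha> (int k)))"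
  have freq: "ennreal (C * ?t k) \<le> ?S" if "k \<in> {1..}" for k
  proof -
    have t0: "0 \<le> ?t k"
      using less_imp_le[OF assms(5)] less_imp_le[OF assms(6)] less_imp_le[OF assms(7)] by simp
    have "C * ?t k = (1 - sqrt 3 / 2) / 8 * (\<zeta>\<^sup>2 * r / D\<^sup>2 * ?t k)"
      unfolding C_def inv by simp
    also have "\<dots> \<le> 1 / 32 * (\<zeta>\<^sup>2 * r / D\<^sup>2 * ?t k)"
    proof (intro mult_right_mono s3 mult_nonneg_nonneg[OF _ t0])
      show "0 \<le> \<zeta>\<^sup>2 * r / D\<^sup>2" using \<open>r > 0\<close> by simp
    qed
    finally have "C * ?t k \<le> ?t k * \<zeta>\<^sup>2 * r / D\<^sup>2 / 32" by (simp add: mult_ac)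
    then have "ennreal (C * ?t k) \<le> ennreal (?t k * \<zeta>\<^sup>2 * r / D\<^sup>2 / 32)" by (rule ennreal_leI)
    also have "\<dots> \<le> (SUP lam\<in>Lambda_class \<gamma> r. SUP f\<in>F_class \<alpha> (D ^ 4). risk \<omega> (P lam f) n m N Y est lam)"
      using that by (intro minimax_risk_ge_frequency[where f = f] est f(2) assms(1,3,4,5,6,7,8,10,11,14) \<alpha>1 D(1) \<zeta>)
        (simp_all add: D f model)
    finally show ?thesis by (simp add: D)
  qed
  show "ennreal ((1 - sqrt 3 / 2) / 8 * \<zeta>\<^sup>2 * r * d powr (- 1 / 2) * Phi \<omega> \<gamma> \<alpha> m) \<le> ?S"
    unfolding C_def[symmetric]
  \<comment> \<open>\<open>C = 0\<close> happens for \<open>d = 1\<close>, where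
    \<open>\<zeta>\<close> vanishes. In the main case, division by \<open>C\<close> turns the bounds
    at the single frequencies into a bound on the supremum \<open>Phi\<close>.\<close>
  proof (cases "C = 0 \<or> ?S = \<infinity>")
    case False
    then obtain s where s: "?S = ennreal s" "0 \<le> s" by (cases ?S) auto
    have C: "0 < C" using False C0 by simp
    have "Phi \<omega> \<gamma> \<alpha> m \<le> s / C"
      unfolding Phi_def
    proof (rule cSUP_least)
      fix k :: nat assume "k \<in> {1..}"
      from freq[OF this] have "C * ?t k \<le> s" unfolding s(1) using s(2) by (simp only: ennreal_le_iff)
      then show "?t k \<le> s / C" using C by (simp add: pos_le_divide_eq mult.commute)
    qed simp
    then have "C * Phi \<omega> \<gamma> \<alpha> m \<le> s" using C by (simp add: pos_le_divide_eq mult.commute)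
    then show "ennreal (C * Phi \<omega> \<gamma> \<alpha> m) \<le> ?S" unfolding s(1) by (rule ennreal_leI)
  next
    case True
    then show "ennreal (C * Phi \<omega> \<gamma> \<alpha> m) \<le> ?S"
    proof
      assume S: "?S = \<infinity>"
      show ?thesis unfolding S by simp
    qed simp
  qed
qed

end
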